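(* Let $q$ be a prime power and let $k$ be a positive integer relatively prime to $q$. Let $$z^k-1 = \phi_1(z) \phi_2(z) \cdots \phi_r(z)$$ be the factorization of $z^k-1$ over $\mathbf{F}_q$ into distinct irreducible polynomials, with $d_i = \deg \phi_i$, and for $n\geq 1$ let $a_n$ be the number of $n \times n$ matrices $A$ over $\mathbf{F}_q$ satisfying $A^k=I$. Then $$1 + \sum_{n \geq 1} \frac{a_n}{\gamma_n}u^n = \prod_{i=1}^r \sum_{m \geq 0} \frac{u^{md_i}}{\gamma_m(q^{d_i})} .$$
   Context: $\mathbf{F}_q$ is the field with $q$ elements. For a prime power $Q$, $\gamma_m(Q)=|\mathrm{GL}_m(Q)|=(Q^m-1)(Q^m-Q)\cdots(Q^m-Q^{m-1})$ is the order of the group of invertible $m\times m$ matrices over the field with $Q$ elements, with $\gamma_0(Q)=1$; $\gamma_n$ denotes $\gamma_n(q)$. $I$ is the identity matrix. The identity is one of formal power series in $u$. *)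

theory Defs
  imports
    "HOL-Computational_Algebra.Computational_Algebra"
    "HOL-Number_Theory.Prime_Powers"
    "HOL-Library.Cardinality"
    "Jordan_Normal_Form.Matrix"
begin

text \<open>
  The order of the general linear group of degree \<open>m\<close> over the field with \<open>Q\<close> elements.
  It is given by its product formula because it is needed for \<open>Q = q ^ d\<close> with varying
  \<open>d\<close>, where no type with \<open>Q\<close> elements is available.
\<close>

definition GL_order :: "nat \<Rightarrow> nat \<Rightarrow> rat" where
  "GL_order m Q = (\<Prod>j<m. of_nat Q ^ m - of_nat Q ^ j)"

text \<open>
  For \<open>d > 0\<close> the partial sums of \<open>\<Sum>m. c m * X ^ (m * d)\<close> converge in the
  metric on formal power series, so \<^const>\<open>suminf\<close> denotes the intended series.
\<close>

lemma fps_sums_compose_power: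
  assumes "d > 0"
  shows "(\<lambda>m. fps_const (c m) * fps_X ^ (m*d)) sums (Abs_fps (c::nat\<Rightarrow>rat) oo fps_X ^ d)"
  unfolding sums_def
proof (rule metric_LIMSEQ_I)
  fix r::real assume "r>0"
  then obtain N where N: "inverse (2^N) < r"
    by (metis inverse_eq_divide one_less_numeral_iff reals_power_lt_ex semiring_norm(76) power_one_over one_add_one zero_less_numeral)
  have "dist (\<Sum>m<n. fps_const (c m) * fps_X ^ (m*d)) (Abs_fps c oo fps_X ^ d) < r" if n: "n \<ge> Suc N" for n
  proof -
    let ?a = "(\<Sum>m<n. fps_const (c m) * fps_X ^ (m*d))"
    have A: "?a $ i = (Abs_fps c oo fps_X ^ d) $ i" if "i \<le> N" for i
    proof -
      have "?a $ i = (\<Sum>m<n. if i = m*d then c m else 0)" by (simp add: fps_sum_nth if_distrib cong: if_cong)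
      also have "\<dots> = (\<Sum>m\<in>{0..i}. if i = m*d then c m else 0)"
        using assms that n by (intro sum.mono_neutral_right) auto
      also have "\<dots> = (Abs_fps c oo fps_X ^ d) $ i"
        by (simp add: fps_compose_nth power_mult[symmetric] mult.commute if_distrib cong: if_cong)
      finally show ?thesis .
    qed
    show ?thesis
    proof (cases "?a = (Abs_fps c oo fps_X ^ d)")
      case False
      then have "subdegree (?a - (Abs_fps c oo fps_X ^ d)) \<ge> N"
        by (intro subdegree_geI) (auto simp: A)
      then have "dist ?a (Abs_fps c oo fps_X ^ d) \<le> inverse (2^N)"
        using False by (simp add: dist_fps_def)
      then show ?thesis using N by simp
    qed (use \<open>r>0\<close> in auto)
  qed
  then show "\<exists>no. \<forall>n\<ge>no. dist (\<Sum>m<n. fps_const (c m) * fps_X ^ (m*d)) (Abs_fps c oo fps_X ^ d) < r" by blast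
qed

end

theory Submission
  imports Defs
begin

text \<open>
  A matrix \<open>A\<close> with \<open>A^k = I\<close> turns \<open>K^n\<close>, where \<open>K\<close> is the field with \<open>q\<close> elements, into a module
  over \<open>K[z]/(z^k - 1)\<close>. As \<open>k\<close> is prime to \<open>q\<close>, the polynomial \<open>z^k - 1\<close> is squarefree, so this
  module is a direct sum of copies of the fields \<open>K[z]/(\<phi>_i)\<close>; the number \<open>m_i\<close> of copies is
  determined by \<open>q^(d_i m_i) = |ker \<phi>_i(A)|\<close>, and \<open>\<Sum> m_i d_i = n\<close>. Comparing coefficients of \<open>u^n\<close>,
  the claim is that there are exactly \<open>\<gamma>_n / \<Prod> \<gamma>_(m_i)(q^(d_i))\<close> matrices with given \<open>m_1, \<dots>, m_r\<close>.

  These matrices form one orbit under conjugation, and the denominator is the order of the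
  centralizer of a member. The proof below counts the same thing without decomposing modules,
  choosing normal forms or speaking of centralizers. Fix a list \<open>\<psi>_1, \<dots>, \<psi>_s\<close> in which each \<open>\<phi>_i\<close>
  occurs \<open>m_i\<close> times. A frame of \<open>A\<close> for this list consists of vectors \<open>v_1, \<dots>, v_s\<close> with
  \<open>\<psi>_j(A) v_j = 0\<close> for which the vectors \<open>A^t v_j\<close> with \<open>t < deg \<psi>_j\<close> are linearly independent.
  The pairs \<open>(A, frame)\<close> are counted in two ways.

  \<^item> An ordered basis of \<open>K^n\<close> can be read in exactly one way as the list of the \<open>A^t v_j\<close> for a pair
    \<open>(A, frame)\<close>: the basis contains the \<open>v_j\<close>, and it prescribes what \<open>A\<close> does to each of its
    members. So the number of pairs is the number \<open>\<gamma>_n\<close> of ordered bases (\<open>sum_card_mat_frames\<close>).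

  \<^item> For a fixed \<open>A\<close> the vectors of a frame are chosen one after the other. A vector
    \<open>v \<in> ker \<psi>(A)\<close> is admissible precisely if it lies outside the submodule \<open>U\<close> generated by its
    predecessors, and \<open>U \<inter> ker \<phi>_i(A)\<close> has \<open>q^(d_i j)\<close> elements if \<open>j\<close> of the predecessors belong
    to \<open>\<phi>_i\<close>. Hence there are \<open>\<Prod>_i \<Prod>_(j<m_i) (|ker \<phi>_i(A)| - q^(d_i j))\<close> frames (\<open>card_frames\<close>).
    For \<open>\<Sum> m_i d_i = n\<close> a frame generates \<open>K^n\<close>. So frames exist only if \<open>A\<close> has the multiplicities
    \<open>m_i\<close>, and then there are \<open>\<Prod> \<gamma>_(m_i)(q^(d_i))\<close> of them (\<open>card_mat_frames\<close>).

  Every \<open>A\<close> with \<open>A^k = I\<close> has exactly one system of multiplicities (\<open>ex1_type\<close>), since a frame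
  that cannot be prolonged generates \<open>K^n\<close> (\<open>ex_full_frame\<close>). All of this rests on one fact about an
  irreducible \<open>\<psi>\<close> and an invariant subspace \<open>U\<close> that contains \<open>\<psi>(A) v\<close> but not \<open>v\<close>: the polynomials
  that map \<open>v\<close> into \<open>U\<close> are the multiples of \<open>\<psi>\<close> (\<open>irreducible_dvd_conductor\<close>).
\<close>


section \<open>Spans over a finite field\<close>

locale finite_field_space = vector_space scale
  for scale :: "'a::finite_field \<Rightarrow> 'b::ab_group_add \<Rightarrow> 'b" (infixr "*s" 75)
begin

lemma card_span_insert:
  assumes "w \<notin> span S" and "finite (span S)"
  shows "card (span (insert w S)) = CARD('a) * card (span S)"
proof -
  have "bij_betw (\<lambda>(c, u). c *s w + u) (UNIV \<times> span S) (span (insert w S))"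
    unfolding bij_betw_def
  proof
    show "inj_on (\<lambda>(c, u). c *s w + u) (UNIV \<times> span S)"
    proof (rule inj_onI, clarify)
      fix c u c' u'
      assume *: "u \<in> span S" "u' \<in> span S" "c *s w + u = c' *s w + u'"
      have "(c - c') *s w = u' - u"
        using *(3) by (simp add: scale_left_diff_distrib algebra_simps)
      moreover have "u' - u \<in> span S"
        using * by (intro span_diff)
      ultimately have "c = c'"
        using assms(1) by (metis right_minus_eq scale_one scale_scale span_scale left_inverse)
      then show "c = c' \<and> u = u'" using * by simp
    qed
    show "(\<lambda>(c, u). c *s w + u) ` (UNIV \<times> span S) = span (insert w S)"
    proof (intro equalityI subsetI)
      fix x assume "x \<in> span (insert w S)"
      then obtain c where "x - c *s w \<in> span S"
        using span_breakdown_eq by blast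
      then show "x \<in> (\<lambda>(c, u). c *s w + u) ` (UNIV \<times> span S)"
        by (intro image_eqI[of _ _ "(c, x - c *s w)"]) auto
    next
      fix x assume "x \<in> (\<lambda>(c, u). c *s w + u) ` (UNIV \<times> span S)"
      then obtain c u where "x = c *s w + u" "u \<in> span S" by auto
      then show "x \<in> span (insert w S)"
        unfolding span_breakdown_eq by (intro exI[of _ c]) simp
    qed
  qed
  then have "card ((UNIV :: 'a set) \<times> span S) = card (span (insert w S))"
    by (rule bij_betw_same_card)
  then show ?thesis by (simp add: card_cartesian_product)
qed

lemma card_span_basis:
  assumes "distinct ws" and "independent (set ws)"
  shows "finite (span (set ws)) \<and> card (span (set ws)) = CARD('a) ^ length ws"
  using assms
proof (induction ws)
  case (Cons w ws)
  then have "w \<notin> span (set ws)" "finite (span (set ws))" "card (span (set ws)) = CARD('a) ^ length ws"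
    by (auto simp: independent_insert)
  then have "card (span (set (w # ws))) = CARD('a) ^ length (w # ws)"
    using card_span_insert by simp
  moreover have "CARD('a) ^ length (w # ws) > 0"
    by simp
  ultimately show ?case
    using card_ge_0_finite by metis
qed simp

text \<open>
  A basis \<open>ws\<close> that arises from a frame consists of blocks, one for each polynomial \<open>\<psi>\<close> of the list;
  the block of \<open>\<psi>\<close> is \<open>T^(d-1) v, \<dots>, T v, v\<close> for \<open>d = deg \<psi>\<close>. The next three functions read off from
  \<open>ws\<close> alone what the frame and the operator \<open>T\<close> must be: \<open>heads\<close> returns the vectors \<open>v\<close>, and \<open>images\<close>
  the values of \<open>T\<close> on \<open>ws\<close>. Inside a block \<open>T\<close> moves each entry to the one before it, and
  \<open>top_image\<close> is the value of \<open>T^d v\<close> that solves \<open>\<psi>(T) v = 0\<close>.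
\<close>

fun heads :: "'a poly list \<Rightarrow> 'b list \<Rightarrow> 'b list" where
  "heads [] ws = []"
| "heads (\<psi> # \<psi>s) ws = ws ! (degree \<psi> - 1) # heads \<psi>s (drop (degree \<psi>) ws)"

definition top_image :: "'a poly \<Rightarrow> 'b list \<Rightarrow> 'b" where
  "top_image \<psi> b = - (\<Sum>t<degree \<psi>. (coeff \<psi> t / lead_coeff \<psi>) *s (b ! (degree \<psi> - 1 - t)))"

fun images :: "'a poly list \<Rightarrow> 'b list \<Rightarrow> 'b list" where
  "images [] ws = []"
| "images (\<psi> # \<psi>s) ws =
     top_image \<psi> (take (degree \<psi>) ws) # butlast (take (degree \<psi>) ws) @ images \<psi>s (drop (degree \<psi>) ws)"

lemma set_heads_subset:
  assumes "\<And>\<psi>. \<psi> \<in> set \<psi>s \<Longrightarrow> degree \<psi> > 0" and "length ws = sum_list (map degree \<psi>s)"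
  shows "set (heads \<psi>s ws) \<subseteq> set ws"
  using assms
proof (induction \<psi>s arbitrary: ws)
  case (Cons \<psi> \<psi>s)
  have "degree \<psi> > 0" using Cons.prems by simp
  then have "degree \<psi> - 1 < length ws"
    using Cons.prems(2) by simp
  moreover have "set (heads \<psi>s (drop (degree \<psi>) ws)) \<subseteq> set (drop (degree \<psi>) ws)"
    using Cons.prems by (intro Cons.IH) auto
  ultimately show ?case
    using set_drop_subset[of "degree \<psi>" ws] by auto
qed simp

lemma length_images:
  assumes "\<And>\<psi>. \<psi> \<in> set \<psi>s \<Longrightarrow> degree \<psi> > 0" and "length ws = sum_list (map degree \<psi>s)"
  shows "length (images \<psi>s ws) = length ws"
  using assms by (induction \<psi>s arbitrary: ws) auto

lemma set_images_subset:
  assumes V: "subspace V" and ws: "set ws \<subseteq> V"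
    and "\<And>\<psi>. \<psi> \<in> set \<psi>s \<Longrightarrow> degree \<psi> > 0" and "length ws = sum_list (map degree \<psi>s)"
  shows "set (images \<psi>s ws) \<subseteq> V"
  using assms(2-)
proof (induction \<psi>s arbitrary: ws)
  case (Cons \<psi> \<psi>s)
  let ?b = "take (degree \<psi>) ws"
  have "?b ! (degree \<psi> - 1 - t) \<in> V" if "t < degree \<psi>" for t
  proof -
    have "?b ! (degree \<psi> - 1 - t) \<in> set ?b"
      using that Cons.prems by (intro nth_mem) auto
    then show ?thesis using Cons.prems(1) set_take_subset[of "degree \<psi>" ws] by blast
  qed
  then have "top_image \<psi> ?b \<in> V"
    unfolding top_image_def using V by (auto intro!: subspace_neg subspace_sum subspace_scale)
  moreover have "set (butlast ?b) \<subseteq> V"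
    using Cons.prems(1) set_take_subset[of "degree \<psi>" ws] in_set_butlastD[of _ ?b] by blast
  moreover have "set (images \<psi>s (drop (degree \<psi>) ws)) \<subseteq> V"
    using Cons.prems set_drop_subset[of "degree \<psi>" ws] by (intro Cons.IH) auto
  ultimately show ?case by auto
qed simp

end

section \<open>Polynomials in a linear operator\<close>

locale operator_on = finite_field_space scale
  for scale :: "'a::finite_field \<Rightarrow> 'b::ab_group_add \<Rightarrow> 'b" (infixr "*s" 75) +
  fixes T :: "'b \<Rightarrow> 'b" and V :: "'b set"
  assumes T_add: "T (u + v) = T u + T v"
    and T_scale: "T (c *s v) = c *s T v"
    and subspace_V: "subspace V"
    and finite_V: "finite V"
    and T_in_V: "v \<in> V \<Longrightarrow> T v \<in> V"
begin

lemma T_0: "T 0 = 0"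
  using T_scale[of 0 0] by simp

lemma T_sum: "T (sum f S) = (\<Sum>s\<in>S. T (f s))"
  by (induction S rule: infinite_finite_induct) (simp_all add: T_0 T_add)

lemma T_pow_add: "(T ^^ i) (u + v) = (T ^^ i) u + (T ^^ i) v"
  by (induction i) (simp_all add: T_add)

lemma T_pow_scale: "(T ^^ i) (c *s v) = c *s (T ^^ i) v"
  by (induction i) (simp_all add: T_scale)

definition act :: "'a poly \<Rightarrow> 'b \<Rightarrow> 'b" where
  "act p v = (\<Sum>i\<le>degree p. coeff p i *s (T ^^ i) v)"

lemma act_eq_sum:
  assumes "degree p \<le> N"
  shows "act p v = (\<Sum>i\<le>N. coeff p i *s (T ^^ i) v)"
  unfolding act_def using assms
  by (intro sum.mono_neutral_left) (auto simp: coeff_eq_0)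

lemma act_0 [simp]: "act 0 v = 0"
  by (simp add: act_def)

lemma act_1 [simp]: "act 1 v = v"
  by (simp add: act_def)

lemma act_monom: "act (monom c i) v = c *s (T ^^ i) v"
proof -
  have "act (monom c i) v = (\<Sum>j\<le>i. coeff (monom c i) j *s (T ^^ j) v)"
    by (rule act_eq_sum) (rule degree_monom_le)
  also have "\<dots> = (\<Sum>j\<le>i. if j = i then c *s (T ^^ j) v else 0)"
    by (intro sum.cong) auto
  finally show ?thesis by simp
qed

lemma act_add_left: "act (p + q) v = act p v + act q v"
proof -
  define N where "N = max (degree p) (degree q)"
  have "degree p \<le> N" "degree q \<le> N" "degree (p + q) \<le> N"
    by (auto simp: N_def intro: degree_add_le_max)
  then show ?thesis
    by (simp add: act_eq_sum scale_left_distrib sum.distrib)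
qed

lemma act_scale: "act p (c *s v) = c *s act p v"
  by (simp add: act_def T_pow_scale scale_sum_right mult.commute)

lemma act_add: "act p (u + v) = act p u + act p v"
  by (simp add: act_def T_pow_add scale_right_distrib sum.distrib)

lemma act_zero [simp]: "act p 0 = 0"
  using act_scale[of p 0 0] by simp

lemma act_neg: "act p (- v) = - act p v"
  using act_add[of p v "- v"] by (simp add: eq_neg_iff_add_eq_0 add.commute)

lemma act_diff_left: "act (p - q) v = act p v - act q v"
  using act_add_left[of "p - q" q v] by (simp add: algebra_simps)

lemma act_smult: "act (Polynomial.smult c p) v = c *s act p v"
proof -
  have "act (Polynomial.smult c p) v = (\<Sum>i\<le>degree p. coeff (Polynomial.smult c p) i *s (T ^^ i) v)"
    by (rule act_eq_sum) (rule degree_smult_le)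
  then show ?thesis by (simp add: act_def scale_sum_right)
qed

lemma act_pCons: "act (pCons a p) v = a *s v + act p (T v)"
proof -
  have "act (pCons a p) v = (\<Sum>i\<le>Suc (degree p). coeff (pCons a p) i *s (T ^^ i) v)"
    by (rule act_eq_sum) (rule degree_pCons_le)
  also have "\<dots> = a *s v + (\<Sum>i\<le>degree p. coeff p i *s (T ^^ Suc i) v)"
    by (subst sum.atMost_Suc_shift) simp
  finally show ?thesis
    by (simp add: act_def funpow_swap1)
qed

lemma T_act: "T (act p v) = act p (T v)"
  by (simp add: act_def T_sum T_scale funpow_swap1)

lemma act_mult: "act (p * q) v = act p (act q v)"
proof (induction p arbitrary: v)
  case (pCons a p)
  have "act (pCons a p * q) v = a *s act q v + act (p * q) (T v)"
    by (simp add: act_add_left act_smult act_pCons mult_pCons_left)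
  then show ?case
    using pCons.IH by (simp add: act_pCons T_act)
qed simp

lemma act_commute: "act p (act q v) = act q (act p v)"
  by (metis act_mult mult.commute)

definition invariant :: "'b set \<Rightarrow> bool" where
  "invariant U \<longleftrightarrow> subspace U \<and> (\<forall>u\<in>U. T u \<in> U)"

lemma act_in_invariant:
  assumes "invariant U" and "u \<in> U"
  shows "act p u \<in> U"
proof -
  have "(T ^^ i) u \<in> U" for i
    using assms by (induction i) (auto simp: invariant_def)
  then show ?thesis
    using assms by (auto simp: act_def invariant_def intro!: subspace_sum subspace_scale)
qed

lemma invariant_V: "invariant V"
  using subspace_V T_in_V by (simp add: invariant_def)

text \<open>
  The polynomials that send \<open>v\<close> into \<open>U\<close> form an ideal. It contains the irreducible \<open>\<psi>\<close> but not \<open>1\<close>,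
  and \<open>K[z]\<close> is a principal ideal domain, so \<open>\<psi>\<close> generates it.
\<close>

lemma irreducible_dvd_conductor:
  assumes U: "invariant U" and \<psi>: "irreducible \<psi>"
    and v: "v \<notin> U" and \<psi>v: "act \<psi> v \<in> U" and p: "act p v \<in> U"
  shows "\<psi> dvd p"
proof -
  define J where "J = {p. act p v \<in> U}"
  have sub: "subspace U" using U by (simp add: invariant_def)
  have mult: "a * b \<in> J" if "b \<in> J" for a b
    using that act_in_invariant[OF U] by (simp add: J_def act_mult)
  have diff: "a - b \<in> J" if "a \<in> J" "b \<in> J" for a b
    using that subspace_diff[OF sub] by (simp add: J_def act_diff_left)
  have "\<psi> \<in> J - {0}" using \<psi> \<psi>v by (auto simp: J_def)
  \<comment> \<open>An element of least degree generates the ideal.\<close>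
  then obtain g where g: "g \<in> J - {0}" and gmin: "\<And>h. h \<in> J - {0} \<Longrightarrow> degree g \<le> degree h"
    using ex_has_least_nat[of "\<lambda>h. h \<in> J - {0}" \<psi> degree] by blast
  have gdvd: "g dvd h" if "h \<in> J" for h
  proof -
    have "h mod g = h - (h div g) * g"
      by (simp add: minus_div_mult_eq_mod)
    then have "h mod g \<in> J"
      using diff mult that g by auto
    moreover have "h mod g = 0 \<or> degree (h mod g) < degree g"
      using degree_mod_less g by blast
    ultimately show ?thesis
      using gmin[of "h mod g"] by (metis Diff_iff dvd_eq_mod_eq_0 insertE empty_iff not_less)
  qed
  have "\<not> is_unit g"
  proof
    assume "is_unit g"
    then obtain h where "1 = g * h" by (auto simp: dvd_def)
    then have "1 \<in> J" using mult[of g h] g by (simp add: mult.commute)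
    then show False using v by (simp add: J_def)
  qed
  then have "\<psi> dvd g"
    using \<psi> gdvd[of \<psi>] \<psi>v by (auto simp: irreducible_altdef J_def)
  also have "g dvd p" using gdvd p by (simp add: J_def)
  finally show ?thesis .
qed

definition adjoin :: "'b \<Rightarrow> 'b set \<Rightarrow> 'b set" where
  "adjoin v U = {u + act p v | u p. u \<in> U}"

lemma invariant_adjoin:
  assumes "invariant U"
  shows "invariant (adjoin v U)"
  unfolding invariant_def
proof
  have U: "subspace U" "\<And>u. u \<in> U \<Longrightarrow> T u \<in> U"
    using assms by (auto simp: invariant_def)
  show "subspace (adjoin v U)"
  proof (rule subspaceI)
    show "0 \<in> adjoin v U"
      using subspace_0[OF U(1)] unfolding adjoin_def by (intro CollectI exI[of _ 0]) simp
  next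
    fix x y assume "x \<in> adjoin v U" "y \<in> adjoin v U"
    then obtain u p u' p' where "u \<in> U" "u' \<in> U" "x = u + act p v" "y = u' + act p' v"
      by (auto simp: adjoin_def)
    then show "x + y \<in> adjoin v U"
      unfolding adjoin_def
      by (intro CollectI exI[of _ "u + u'"] exI[of _ "p + p'"])
         (simp add: act_add_left subspace_add[OF U(1)] algebra_simps)
  next
    fix c x assume "x \<in> adjoin v U"
    then obtain u p where "u \<in> U" "x = u + act p v"
      by (auto simp: adjoin_def)
    then show "c *s x \<in> adjoin v U"
      unfolding adjoin_def
      by (intro CollectI exI[of _ "c *s u"] exI[of _ "Polynomial.smult c p"])
         (simp add: act_smult subspace_scale[OF U(1)] scale_right_distrib)
  qed
  show "\<forall>x\<in>adjoin v U. T x \<in> adjoin v U"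
  proof
    fix x assume "x \<in> adjoin v U"
    then obtain u p where "u \<in> U" "x = u + act p v"
      by (auto simp: adjoin_def)
    then show "T x \<in> adjoin v U"
      unfolding adjoin_def
      by (intro CollectI exI[of _ "T u"] exI[of _ "pCons 0 p"])
         (simp add: T_add T_act act_pCons U)
  qed
qed

section \<open>Cyclic submodules and their bases\<close>

text \<open>
  The powers are in descending order, so that each entry is independent of the entries after it;
  this is the order in which lists are taken apart by induction.
\<close>

definition chain :: "nat \<Rightarrow> 'b \<Rightarrow> 'b list" where
  "chain d v = map (\<lambda>t. (T ^^ t) v) (rev [0..<d])"

lemma chain_0 [simp]: "chain 0 v = []"
  by (simp add: chain_def)

lemma chain_Suc [simp]: "chain (Suc d) v = (T ^^ d) v # chain d v"
  by (simp add: chain_def)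

lemma length_chain [simp]: "length (chain d v) = d"
  by (simp add: chain_def)

lemma set_chain: "set (chain d v) = (\<lambda>t. (T ^^ t) v) ` {..<d}"
  by (auto simp: chain_def)

lemma span_chain_subset:
  assumes "subspace U"
  shows "span (set (chain d v) \<union> U) \<subseteq> {u + act p v | u p. u \<in> U \<and> (\<forall>i\<ge>d. coeff p i = 0)}"
    (is "_ \<subseteq> ?S")
proof (rule span_minimal)
  note U = assms
  show "set (chain d v) \<union> U \<subseteq> ?S"
  proof
    fix x assume "x \<in> set (chain d v) \<union> U"
    then consider t where "t < d" "x = (T ^^ t) v" | "x \<in> U"
      by (auto simp: set_chain)
    then show "x \<in> ?S"
    proof cases
      case 1
      then show ?thesis
        using subspace_0[OF U]
        by (intro CollectI exI[of _ 0] exI[of _ "monom 1 t"]) (simp add: act_monom)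
    next
      case 2
      then show ?thesis
        by (intro CollectI exI[of _ x] exI[of _ 0]) simp
    qed
  qed
  show "subspace ?S"
  proof (rule subspaceI)
    show "0 \<in> ?S"
      using subspace_0[OF U] by (intro CollectI exI[of _ 0]) simp
  next
    fix x y assume "x \<in> ?S" "y \<in> ?S"
    then obtain u p u' p' where *: "u \<in> U" "u' \<in> U" "x = u + act p v" "y = u' + act p' v"
      "\<forall>i\<ge>d. coeff p i = 0" "\<forall>i\<ge>d. coeff p' i = 0"
      by blast
    then show "x + y \<in> ?S"
      by (intro CollectI exI[of _ "u + u'"] exI[of _ "p + p'"])
         (simp add: act_add_left subspace_add[OF U] algebra_simps)
  next
    fix c x assume "x \<in> ?S"
    then obtain u p where "u \<in> U" "x = u + act p v" "\<forall>i\<ge>d. coeff p i = 0"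
      by blast
    then show "c *s x \<in> ?S"
      by (intro CollectI exI[of _ "c *s u"] exI[of _ "Polynomial.smult c p"])
         (simp add: act_smult subspace_scale[OF U] scale_right_distrib)
  qed
qed

text \<open>
  A dependency would be a monic polynomial of degree \<open>t < deg \<psi>\<close> that sends \<open>v\<close> into \<open>U\<close>, and such a
  polynomial is no multiple of \<open>\<psi>\<close>.
\<close>

lemma chain_step_notin_span:
  assumes U: "invariant U" and \<psi>: "irreducible \<psi>" "act \<psi> v \<in> U" and v: "v \<notin> U"
    and t: "t < degree \<psi>"
  shows "(T ^^ t) v \<notin> span (set (chain t v) \<union> U)"
proof
  assume "(T ^^ t) v \<in> span (set (chain t v) \<union> U)"
  moreover have "subspace U" using U by (simp add: invariant_def)
  ultimately have "(T ^^ t) v \<in> {u + act p v | u p. u \<in> U \<and> (\<forall>i\<ge>t. coeff p i = 0)}"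
    using span_chain_subset by blast
  then obtain u p where up: "(T ^^ t) v = u + act p v" "u \<in> U" "\<forall>i\<ge>t. coeff p i = 0"
    by auto
  define g where "g = monom 1 t - p"
  have "act g v = u" using up by (simp add: g_def act_diff_left act_monom)
  then have "\<psi> dvd g"
    using irreducible_dvd_conductor[OF U \<psi>(1) v \<psi>(2)] up by simp
  moreover have "coeff g t \<noteq> 0" using up by (simp add: g_def)
  moreover have "degree g \<le> t"
    using up by (intro degree_le) (auto simp: g_def)
  ultimately show False
    using t dvd_imp_degree_le[of \<psi> g] by (metis coeff_0 le_trans not_less)
qed

text \<open>
  Multiples of \<open>\<psi>\<close> send \<open>v\<close> into \<open>U\<close>, and modulo \<open>\<psi>\<close> every polynomial has degree less than \<open>deg \<psi>\<close>.
\<close>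

lemma span_chain_eq_adjoin:
  assumes U: "invariant U" and \<psi>: "\<psi> \<noteq> 0" "act \<psi> v \<in> U"
  shows "span (set (chain (degree \<psi>) v) \<union> U) = adjoin v U"
proof (intro equalityI subsetI)
  fix x assume "x \<in> span (set (chain (degree \<psi>) v) \<union> U)"
  then show "x \<in> adjoin v U"
    using span_chain_subset[of U "degree \<psi>" v] U unfolding invariant_def adjoin_def by blast
next
  let ?S = "set (chain (degree \<psi>) v) \<union> U"
  fix x assume "x \<in> adjoin v U"
  then obtain u p where x: "x = u + act p v" "u \<in> U" by (auto simp: adjoin_def)
  have "act p v = act ((p div \<psi>) * \<psi> + p mod \<psi>) v" by simp
  also have "\<dots> = act (p div \<psi>) (act \<psi> v) + act (p mod \<psi>) v"
    unfolding act_add_left act_mult ..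
  finally have *: "act p v = act (p div \<psi>) (act \<psi> v) + act (p mod \<psi>) v" .
  have "act (p mod \<psi>) v \<in> span ?S"
    unfolding act_def
  proof (intro span_sum)
    fix i assume "i \<in> {..degree (p mod \<psi>)}"
    moreover have "p mod \<psi> = 0 \<or> degree (p mod \<psi>) < degree \<psi>"
      using \<psi>(1) degree_mod_less by blast
    ultimately consider "p mod \<psi> = 0" "i = 0" | "i < degree \<psi>" by fastforce
    then show "coeff (p mod \<psi>) i *s (T ^^ i) v \<in> span ?S"
    proof cases
      case 2
      then show ?thesis
        by (intro span_scale span_base) (simp add: set_chain)
    qed (simp add: span_zero)
  qed
  moreover have "act (p div \<psi>) (act \<psi> v) \<in> span ?S" "u \<in> span ?S"
    using x act_in_invariant[OF U \<psi>(2)] by (auto intro: span_base)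
  ultimately show "x \<in> span ?S"
    using x * by (simp add: span_add)
qed

lemma card_adjoin:
  assumes U: "invariant U" "finite U" and \<psi>: "irreducible \<psi>" "act \<psi> v \<in> U" and v: "v \<notin> U"
  shows "card (adjoin v U) = CARD('a) ^ degree \<psi> * card U"
proof -
  have fin: "finite (span (set (chain t v) \<union> U))
      \<and> card (span (set (chain t v) \<union> U)) = CARD('a) ^ t * card U"
    if "t \<le> degree \<psi>" for t
    using that
  proof (induction t)
    case 0
    have "span U = U"
      using U by (simp add: invariant_def)
    then show ?case using U by (simp del: span_eq_iff)
  next
    case (Suc t)
    let ?S = "set (chain t v) \<union> U"
    have S: "(T ^^ t) v \<notin> span ?S" "finite (span ?S)" "card (span ?S) = CARD('a) ^ t * card U"
      using Suc chain_step_notin_span[OF U(1) \<psi> v, of t] by auto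
    then have "card (span (insert ((T ^^ t) v) ?S)) = CARD('a) ^ Suc t * card U"
      using card_span_insert by simp
    moreover have "card U > 0"
      using U by (metis card_gt_0_iff empty_iff invariant_def subspace_0)
    ultimately show ?case
      by (simp add: card_ge_0_finite)
  qed
  have "\<psi> \<noteq> 0" using \<psi> by auto
  then show ?thesis
    using fin[of "degree \<psi>"] span_chain_eq_adjoin[OF U(1) _ \<psi>(2)] by simp
qed

lemma chain_nth: "t < d \<Longrightarrow> chain d v ! (d - 1 - t) = (T ^^ t) v"
  by (simp add: chain_def rev_nth)

text \<open>
  Whether \<open>b\<close> is the chain of a vector killed by \<open>\<psi>(T)\<close> depends on \<open>T\<close> only through its values on \<open>b\<close>.
  This makes the correspondence between bases and pairs of an operator and a frame bijective.
\<close>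

lemma chain_iff:
  assumes "degree \<psi> > 0" and "length b = degree \<psi>"
  shows "chain (degree \<psi>) v = b \<and> act \<psi> v = 0 \<longleftrightarrow>
    v = b ! (degree \<psi> - 1) \<and> map T b = top_image \<psi> b # butlast b"
proof -
  obtain d where d: "degree \<psi> = Suc d" using assms(1) by (cases "degree \<psi>") auto
  have lc: "lead_coeff \<psi> \<noteq> 0" using assms by auto
  have top: "act \<psi> v = 0 \<longleftrightarrow> T ((T ^^ d) v) = top_image \<psi> b" if b: "chain (degree \<psi>) v = b"
  proof -
    have "top_image \<psi> b = - (\<Sum>t<degree \<psi>. (coeff \<psi> t / lead_coeff \<psi>) *s (T ^^ t) v)"
      unfolding top_image_def b[symmetric]
      by (intro arg_cong[of _ _ uminus] sum.cong refl) (simp only: lessThan_iff chain_nth)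
    also have "\<dots> = - (inverse (lead_coeff \<psi>) *s (\<Sum>t<degree \<psi>. coeff \<psi> t *s (T ^^ t) v))"
      by (simp add: scale_sum_right divide_inverse mult.commute)
    finally have 1: "top_image \<psi> b = - (inverse (lead_coeff \<psi>) *s (\<Sum>t<degree \<psi>. coeff \<psi> t *s (T ^^ t) v))" .
    have 2: "act \<psi> v = (\<Sum>t<degree \<psi>. coeff \<psi> t *s (T ^^ t) v) + lead_coeff \<psi> *s (T ^^ Suc d) v"
      unfolding act_def d by (simp flip: lessThan_Suc_atMost)
    have 3: "inverse (lead_coeff \<psi>) *s act \<psi> v = T ((T ^^ d) v) - top_image \<psi> b"
      unfolding 1 2 using lc by (simp add: scale_right_distrib)
    show ?thesis
    proof
      assume "act \<psi> v = 0"
      then show "T ((T ^^ d) v) = top_image \<psi> b" using 3 by simp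
    next
      assume "T ((T ^^ d) v) = top_image \<psi> b"
      then have "inverse (lead_coeff \<psi>) *s act \<psi> v = 0" using 3 by simp
      then show "act \<psi> v = 0" using lc by simp
    qed
  qed
  have map_chain: "map T (chain (Suc m) v) = T ((T ^^ m) v) # butlast (chain (Suc m) v)" for m
    by (induction m) simp_all
  show ?thesis
  proof
    assume *: "chain (degree \<psi>) v = b \<and> act \<psi> v = 0"
    then have "b ! (degree \<psi> - 1) = v"
      using chain_nth[of 0 "degree \<psi>" v] assms(1) by simp
    then show "v = b ! (degree \<psi> - 1) \<and> map T b = top_image \<psi> b # butlast b"
      using * top map_chain[of d] d by simp
  next
    assume *: "v = b ! (degree \<psi> - 1) \<and> map T b = top_image \<psi> b # butlast b"
    have nth: "b ! (d - t) = (T ^^ t) v" if "t \<le> d" for t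
      using that
    proof (induction t)
      case (Suc t)
      have "b ! (d - Suc t) = butlast b ! (d - Suc t)"
        using Suc.prems assms d by (simp add: nth_butlast)
      also have "\<dots> = map T b ! (d - t)"
        using * Suc.prems by (simp add: nth_Cons' Suc_diff_Suc[symmetric])
      also have "\<dots> = T (b ! (d - t))"
        using assms d by simp
      finally show ?case using Suc by simp
    qed (use * d in simp)
    have chain: "chain (degree \<psi>) v = b"
    proof (rule nth_equalityI)
      fix i assume "i < length (chain (degree \<psi>) v)"
      then have i: "i \<le> d" by (simp add: d)
      then have "chain (degree \<psi>) v ! i = (T ^^ (d - i)) v"
        using chain_nth[of "d - i" "degree \<psi>" v] by (simp add: d)
      then show "chain (degree \<psi>) v ! i = b ! i"
        using nth[of "d - i"] i by simp
    qed (simp add: assms)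
    moreover have "T ((T ^^ d) v) = top_image \<psi> b"
      using * chain d map_chain[of d] by simp
    ultimately show "chain (degree \<psi>) v = b \<and> act \<psi> v = 0"
      using top by simp
  qed
qed

section \<open>Frames of an operator\<close>

fun chains :: "'a poly list \<Rightarrow> 'b list \<Rightarrow> 'b list" where
  "chains (\<psi> # \<psi>s) (v # vs) = chain (degree \<psi>) v @ chains \<psi>s vs"
| "chains _ _ = []"

lemma length_chains:
  "length vs = length \<psi>s \<Longrightarrow> length (chains \<psi>s vs) = sum_list (map degree \<psi>s)"
  by (induction \<psi>s vs rule: chains.induct) auto

lemma chains_iff:
  assumes "\<And>\<psi>. \<psi> \<in> set \<psi>s \<Longrightarrow> degree \<psi> > 0" and "length ws = sum_list (map degree \<psi>s)"
  shows "list_all2 (\<lambda>\<psi> v. act \<psi> v = 0) \<psi>s vs \<and> chains \<psi>s vs = ws \<longleftrightarrow>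
    vs = heads \<psi>s ws \<and> map T ws = images \<psi>s ws"
  using assms
proof (induction \<psi>s arbitrary: vs ws)
  case (Cons \<psi> \<psi>s)
  let ?b = "take (degree \<psi>) ws" and ?r = "drop (degree \<psi>) ws"
  have len: "length ?b = degree \<psi>" "length ?r = sum_list (map degree \<psi>s)"
    using Cons.prems by auto
  have pos: "degree \<psi> > 0" using Cons.prems by simp
  have split: "map T ws = map T ?b @ map T ?r"
    by (simp flip: map_append)
  have nth: "ws ! (degree \<psi> - 1) = ?b ! (degree \<psi> - 1)"
    using pos by simp
  have "list_all2 (\<lambda>\<psi> v. act \<psi> v = 0) (\<psi> # \<psi>s) (v # vs') \<and> chains (\<psi> # \<psi>s) (v # vs') = ws \<longleftrightarrow>
      (v # vs') = heads (\<psi> # \<psi>s) ws \<and> map T ws = images (\<psi> # \<psi>s) ws" for v vs'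
  proof -
    have "chains (\<psi> # \<psi>s) (v # vs') = ws \<longleftrightarrow> chain (degree \<psi>) v = ?b \<and> chains \<psi>s vs' = ?r"
      by (metis append_eq_conv_conj append_take_drop_id chains.simps(1) length_chain)
    then have "list_all2 (\<lambda>\<psi> v. act \<psi> v = 0) (\<psi> # \<psi>s) (v # vs') \<and> chains (\<psi> # \<psi>s) (v # vs') = ws \<longleftrightarrow>
        (chain (degree \<psi>) v = ?b \<and> act \<psi> v = 0) \<and>
        (list_all2 (\<lambda>\<psi> v. act \<psi> v = 0) \<psi>s vs' \<and> chains \<psi>s vs' = ?r)"
      by auto
    also have "\<dots> \<longleftrightarrow> (v = ?b ! (degree \<psi> - 1) \<and> map T ?b = top_image \<psi> ?b # butlast ?b) \<and>
        (vs' = heads \<psi>s ?r \<and> map T ?r = images \<psi>s ?r)"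
      using chain_iff[OF pos len(1)] Cons.IH[of ?r vs'] Cons.prems len by simp
    also have "map T ?b = top_image \<psi> ?b # butlast ?b \<and> map T ?r = images \<psi>s ?r \<longleftrightarrow>
        map T ws = images (\<psi> # \<psi>s) ws"
      unfolding split images.simps append_Cons[symmetric]
      using len pos by (subst append_eq_append_conv) auto
    ultimately show ?thesis using nth by auto
  qed
  then show ?case by (cases vs) auto
qed auto

definition frames :: "'a poly list \<Rightarrow> 'b list set" where
  "frames \<psi>s = {vs. list_all2 (\<lambda>\<psi> v. act \<psi> v = 0) \<psi>s vs \<and> set vs \<subseteq> V \<and>
     distinct (chains \<psi>s vs) \<and> independent (set (chains \<psi>s vs))}"

lemma invariant_trivial: "invariant {0}"
  by (simp add: invariant_def T_0)

lemma span_chains_Cons: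
  assumes "\<psi> \<noteq> 0" and "act \<psi> v = 0" and "invariant (span (set (chains \<psi>s vs)))"
  shows "span (set (chains (\<psi> # \<psi>s) (v # vs))) = adjoin v (span (set (chains \<psi>s vs)))"
proof -
  let ?U = "span (set (chains \<psi>s vs))"
  have "span (set (chains (\<psi> # \<psi>s) (v # vs))) = span (set (chain (degree \<psi>) v) \<union> ?U)"
    by (simp add: span_Un span_span)
  also have "\<dots> = adjoin v ?U"
    using assms span_zero by (intro span_chain_eq_adjoin) auto
  finally show ?thesis .
qed

lemma invariant_span_chains:
  assumes "list_all2 (\<lambda>\<psi> v. act \<psi> v = 0) \<psi>s vs" and "0 \<notin> set \<psi>s"
  shows "invariant (span (set (chains \<psi>s vs)))"
  using assms
proof (induction \<psi>s vs rule: list_all2_induct)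
  case (Cons \<psi> \<psi>s v vs)
  then have "invariant (span (set (chains \<psi>s vs)))" "\<psi> \<noteq> 0" by auto
  then show ?case
    using Cons span_chains_Cons[of \<psi> v \<psi>s vs] invariant_adjoin by simp
qed (simp add: invariant_trivial)

lemma set_chains_subset_V:
  assumes "set vs \<subseteq> V"
  shows "set (chains \<psi>s vs) \<subseteq> V"
  using assms
proof (induction \<psi>s vs rule: chains.induct)
  case (1 \<psi> \<psi>s v vs)
  have "(T ^^ t) v \<in> V" for t
    using 1 T_in_V by (induction t) auto
  then show ?case using 1 by (auto simp: set_chain)
qed auto

lemma span_chains_subset_V: "set vs \<subseteq> V \<Longrightarrow> span (set (chains \<psi>s vs)) \<subseteq> V"
  using set_chains_subset_V subspace_V by (intro span_minimal)

lemma finite_frames: "finite (frames \<psi>s)"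
proof (rule finite_subset)
  show "frames \<psi>s \<subseteq> {vs. set vs \<subseteq> V \<and> length vs = length \<psi>s}"
    by (auto simp: frames_def list_all2_lengthD)
  show "finite {vs. set vs \<subseteq> V \<and> length vs = length \<psi>s}"
    using finite_V by (rule finite_lists_length_eq)
qed

lemma frames_Nil [simp]: "frames [] = {[]}"
  by (auto simp: frames_def independent_empty)

text \<open>
  A vector killed by \<open>\<psi>(T)\<close> prolongs a frame as soon as it lies outside the span: the submodule that
  it generates then adds its full dimension \<open>deg \<psi>\<close>, by \<open>chain_step_notin_span\<close>.
\<close>

lemma Cons_in_frames_iff:
  assumes "irreducible \<psi>" and "0 \<notin> set \<psi>s"
  shows "v # vs \<in> frames (\<psi> # \<psi>s) \<longleftrightarrow>
    vs \<in> frames \<psi>s \<and> v \<in> V \<and> act \<psi> v = 0 \<and> v \<notin> span (set (chains \<psi>s vs))"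
proof
  let ?xs = "chains \<psi>s vs"
  assume L: "v # vs \<in> frames (\<psi> # \<psi>s)"
  have "degree \<psi> \<noteq> 0"
    using assms(1) by (metis irreducible_def is_unit_iff_degree)
  then have mem: "v \<in> set (chain (degree \<psi>) v)"
    unfolding set_chain by (intro image_eqI[of _ _ 0]) auto
  have dist: "distinct ?xs" "v \<notin> set ?xs"
    using L mem by (auto simp: frames_def)
  have "independent (insert v (set ?xs))"
    by (rule independent_mono[of "set (chains (\<psi> # \<psi>s) (v # vs))"]) (use L mem in \<open>auto simp: frames_def\<close>)
  then have "independent (set ?xs)" "v \<notin> span (set ?xs)"
    using dist by (auto simp: independent_insert)
  then show "vs \<in> frames \<psi>s \<and> v \<in> V \<and> act \<psi> v = 0 \<and> v \<notin> span (set ?xs)"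
    using L dist by (auto simp: frames_def)
next
  let ?xs = "chains \<psi>s vs" and ?d = "degree \<psi>"
  assume R: "vs \<in> frames \<psi>s \<and> v \<in> V \<and> act \<psi> v = 0 \<and> v \<notin> span (set (chains \<psi>s vs))"
  have inv: "invariant (span (set ?xs))"
    using R assms by (intro invariant_span_chains) (auto simp: frames_def)
  have "distinct (chain t v @ ?xs) \<and> independent (set (chain t v @ ?xs))" if "t \<le> ?d" for t
    using that
  proof (induction t)
    case 0
    then show ?case using R by (simp add: frames_def)
  next
    case (Suc t)
    have "(T ^^ t) v \<notin> span (set (chain t v) \<union> span (set ?xs))"
      using chain_step_notin_span[OF inv assms(1) _ _, of v t] R Suc.prems span_zero by simp
    then have "(T ^^ t) v \<notin> span (set (chain t v @ ?xs))"
      by (simp add: span_Un span_span)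
    then show ?case
      using Suc span_base[of "(T ^^ t) v" "set (chain t v @ ?xs)"]
      by (auto simp: independent_insert)
  qed
  from this[of ?d] show "v # vs \<in> frames (\<psi> # \<psi>s)"
    using R by (auto simp: frames_def)
qed

lemma length_chains_frames:
  assumes "vs \<in> frames \<psi>s"
  shows "length (chains \<psi>s vs) = sum_list (map degree \<psi>s)"
proof (rule length_chains)
  show "length vs = length \<psi>s"
    using assms list_all2_lengthD by (fastforce simp: frames_def)
qed

lemma card_span_chains:
  assumes "vs \<in> frames \<psi>s"
  shows "card (span (set (chains \<psi>s vs))) = CARD('a) ^ sum_list (map degree \<psi>s)"
  using assms card_span_basis[of "chains \<psi>s vs"] length_chains_frames[OF assms]
  by (simp add: frames_def)

definition kernel :: "'a poly \<Rightarrow> 'b set" where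
  "kernel \<psi> = {v \<in> V. act \<psi> v = 0}"

lemma act_eq_0_on_span_chains:
  assumes "list_all2 (\<lambda>\<psi> v. act \<psi> v = 0) \<psi>s vs" and "\<And>\<psi>. \<psi> \<in> set \<psi>s \<Longrightarrow> \<psi> dvd f"
    and "x \<in> span (set (chains \<psi>s vs))"
  shows "act f x = 0"
proof -
  have "act f w = 0" if "w \<in> set (chains \<psi>s vs)" for w
    using assms(1,2) that
  proof (induction \<psi>s vs rule: list_all2_induct)
    case (Cons \<psi> \<psi>s v vs)
    obtain g where "f = g * \<psi>" using Cons.prems(1)[of \<psi>] by (auto simp: dvd_def mult.commute)
    then have "act f v = 0" using Cons by (simp add: act_mult)
    then have "act f ((T ^^ t) v) = 0" for t
      using act_commute[of f "monom 1 t" v] by (simp add: act_monom)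
    then show ?case using Cons by (auto simp: set_chain)
  qed simp
  then have "set (chains \<psi>s vs) \<subseteq> {x. act f x = 0}" by auto
  moreover have "subspace {x. act f x = 0}"
    by (rule subspaceI) (auto simp: act_add act_scale)
  ultimately show ?thesis
    using assms(3) span_minimal by blast
qed

end

section \<open>The number of frames of an operator\<close>

text \<open>
  The set \<open>\<Phi>\<close> will consist of the irreducible factors of \<open>z^k - 1\<close>. It is required that no two of its
  members are associated, which is stronger than being distinct since they need not be monic.
\<close>

locale operator_with_primes = operator_on scale T V
  for scale :: "'a::finite_field \<Rightarrow> 'b::ab_group_add \<Rightarrow> 'b" (infixr "*s" 75)
    and T :: "'b \<Rightarrow> 'b" and V :: "'b set" +
  fixes \<Phi> :: "'a poly set"
  assumes finite_\<Phi>: "finite \<Phi>"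
    and irreducible_\<Phi>: "\<psi> \<in> \<Phi> \<Longrightarrow> irreducible \<psi>"
    and non_associated_\<Phi>: "\<psi> \<in> \<Phi> \<Longrightarrow> \<chi> \<in> \<Phi> \<Longrightarrow> \<psi> dvd \<chi> \<Longrightarrow> \<psi> = \<chi>"
begin

lemma zero_notin_\<Phi>: "set \<psi>s \<subseteq> \<Phi> \<Longrightarrow> 0 \<notin> set \<psi>s"
  using irreducible_\<Phi>[of 0] by auto

text \<open>
  Adjoining a vector \<open>v\<close> of \<open>ker \<psi>(T)\<close> to \<open>U\<close> enlarges \<open>U \<inter> ker \<psi>(T)\<close> by all of the submodule generated by
  \<open>v\<close>. It does not change \<open>U \<inter> ker \<chi>(T)\<close> for another \<open>\<chi>\<close>: a vector of \<open>ker \<psi>(T)\<close> that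
  \<open>\<chi>(T)\<close> maps into \<open>U\<close> already lies in \<open>U\<close>.
\<close>

lemma card_kernel_span_chains:
  assumes "vs \<in> frames \<psi>s" and "set \<psi>s \<subseteq> \<Phi>" and "\<chi> \<in> \<Phi>"
  shows "card {x \<in> span (set (chains \<psi>s vs)). act \<chi> x = 0} = CARD('a) ^ (degree \<chi> * count (mset \<psi>s) \<chi>)"
  using assms(1,2)
proof (induction \<psi>s arbitrary: vs)
  case Nil
  then have "{x \<in> span (set (chains [] vs)). act \<chi> x = 0} = {0}"
    by auto
  then show ?case by simp
next
  case (Cons \<psi> \<psi>s vs')
  then obtain v vs where vs': "vs' = v # vs"
    by (auto simp: frames_def list_all2_Cons1)
  have \<psi>: "irreducible \<psi>" using Cons.prems irreducible_\<Phi> by simp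
  have vs: "vs \<in> frames \<psi>s" and v: "v \<in> V" "act \<psi> v = 0" "v \<notin> span (set (chains \<psi>s vs))"
    using Cons.prems Cons_in_frames_iff[OF \<psi>] zero_notin_\<Phi> vs' by auto
  let ?U = "span (set (chains \<psi>s vs))"
  have U: "invariant ?U"
    using vs Cons.prems by (intro invariant_span_chains zero_notin_\<Phi>) (auto simp: frames_def)
  have fU: "finite ?U"
    using vs span_chains_subset_V[of vs \<psi>s] finite_V by (auto simp: frames_def intro: finite_subset)
  have span: "span (set (chains (\<psi> # \<psi>s) vs')) = adjoin v ?U"
    unfolding vs' using \<psi> v U by (intro span_chains_Cons) auto
  have IH: "card {x \<in> ?U. act \<chi> x = 0} = CARD('a) ^ (degree \<chi> * count (mset \<psi>s) \<chi>)"
    using Cons vs by simp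
  show ?case
  proof (cases "\<psi> = \<chi>")
    case True
    let ?W = "{x \<in> ?U. act \<chi> x = 0}"
    have "act \<chi> (act p v) = 0" for p
      using v True act_commute[of \<chi> p v] by simp
    then have "{x \<in> adjoin v ?U. act \<chi> x = 0} = adjoin v ?W"
      by (fastforce simp: adjoin_def act_add)
    moreover have "invariant ?W"
      using U subspace_0[of ?U] subspace_add[of ?U] subspace_scale[of ?U]
      by (auto simp: invariant_def T_0 act_add act_scale simp flip: T_act intro!: subspaceI)
    then have "card (adjoin v ?W) = CARD('a) ^ degree \<chi> * card ?W"
      using fU \<psi> v True by (intro card_adjoin) (auto simp: span_zero)
    ultimately show ?thesis
      unfolding span using IH True by (simp add: power_add)
  next
    case False
    have "{x \<in> adjoin v ?U. act \<chi> x = 0} = {x \<in> ?U. act \<chi> x = 0}"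
    proof (intro equalityI subsetI)
      fix x assume "x \<in> {x \<in> adjoin v ?U. act \<chi> x = 0}"
      then obtain u p where x: "x = u + act p v" "u \<in> ?U" "act \<chi> x = 0"
        by (auto simp: adjoin_def)
      have "act p v \<in> ?U"
      proof (rule ccontr)
        assume *: "act p v \<notin> ?U"
        have "act \<chi> (act p v) = act \<chi> (- u)"
          using x(1,3) by (simp add: act_add act_neg eq_neg_iff_add_eq_0 add.commute)
        then have "act \<chi> (act p v) \<in> ?U"
          using act_in_invariant[OF U] x(2) by (simp add: span_neg)
        moreover have "act \<psi> (act p v) \<in> ?U"
          using act_commute[of \<psi> p v] v by (simp add: span_zero)
        ultimately have "\<psi> dvd \<chi>"
          using irreducible_dvd_conductor[OF U \<psi> *] by simp
        then show False
          using False Cons.prems non_associated_\<Phi>[of \<psi> \<chi>] assms(3) by simp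
      qed
      then show "x \<in> {x \<in> ?U. act \<chi> x = 0}"
        using x by (simp add: span_add)
    next
      fix x assume "x \<in> {x \<in> ?U. act \<chi> x = 0}"
      moreover from this have "x \<in> adjoin v ?U"
        unfolding adjoin_def by (intro CollectI exI[of _ x] exI[of _ 0]) simp
      ultimately show "x \<in> {x \<in> adjoin v ?U. act \<chi> x = 0}"
        by simp
    qed
    then show ?thesis using IH False by (simp add: span)
  qed
qed

text \<open>
  The choices for the vector \<open>v\<close> put in front of a frame form \<open>ker \<psi>(T)\<close> minus its intersection with the
  span of the frame. The size of this intersection is the same for all frames of the list, so
  the numbers of choices multiply, and the order of the list does not matter.
\<close>

theorem card_frames:
  assumes "set \<psi>s \<subseteq> \<Phi>"
  shows "card (frames \<psi>s) =
    (\<Prod>\<chi>\<in>\<Phi>. \<Prod>j<count (mset \<psi>s) \<chi>. card (kernel \<chi>) - CARD('a) ^ (degree \<chi> * j))"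
  using assms
proof (induction \<psi>s)
  case (Cons \<psi> \<psi>s)
  let ?ker = "\<lambda>vs. {x \<in> span (set (chains \<psi>s vs)). act \<psi> x = 0}"
  let ?c = "card (kernel \<psi>) - CARD('a) ^ (degree \<psi> * count (mset \<psi>s) \<psi>)"
  have \<psi>: "\<psi> \<in> \<Phi>" "irreducible \<psi>" using Cons.prems irreducible_\<Phi> by auto
  have iff: "v # vs \<in> frames (\<psi> # \<psi>s) \<longleftrightarrow> vs \<in> frames \<psi>s \<and> v \<in> kernel \<psi> - ?ker vs" for v vs
    using Cons_in_frames_iff[OF \<psi>(2), of \<psi>s v vs] Cons.prems zero_notin_\<Phi>
    by (auto simp: kernel_def)
  have "frames (\<psi> # \<psi>s) = (\<lambda>(vs, v). v # vs) ` Sigma (frames \<psi>s) (\<lambda>vs. kernel \<psi> - ?ker vs)"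
  proof (intro equalityI subsetI)
    fix xs assume "xs \<in> frames (\<psi> # \<psi>s)"
    moreover from this obtain v vs where "xs = v # vs"
      by (auto simp: frames_def list_all2_Cons1)
    ultimately show "xs \<in> (\<lambda>(vs, v). v # vs) ` Sigma (frames \<psi>s) (\<lambda>vs. kernel \<psi> - ?ker vs)"
      using iff by (auto intro!: image_eqI[of _ _ "(vs, v)"])
  qed (use iff in auto)
  moreover have "inj_on (\<lambda>(vs, v). v # vs) (Sigma (frames \<psi>s) (\<lambda>vs. kernel \<psi> - ?ker vs))"
    by (auto simp: inj_on_def)
  ultimately have "card (frames (\<psi> # \<psi>s)) = card (Sigma (frames \<psi>s) (\<lambda>vs. kernel \<psi> - ?ker vs))"
    by (simp add: card_image)
  also have "\<dots> = (\<Sum>vs\<in>frames \<psi>s. card (kernel \<psi> - ?ker vs))"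
    using finite_frames finite_V by (intro card_SigmaI) (auto simp: kernel_def)
  also have "\<dots> = (\<Sum>vs\<in>frames \<psi>s. ?c)"
  proof (intro sum.cong refl)
    fix vs assume vs: "vs \<in> frames \<psi>s"
    then have sub: "?ker vs \<subseteq> kernel \<psi>"
      using span_chains_subset_V[of vs \<psi>s] by (auto simp: kernel_def frames_def)
    moreover have "finite (?ker vs)"
      using sub finite_V by (auto simp: kernel_def intro: finite_subset)
    ultimately show "card (kernel \<psi> - ?ker vs) = ?c"
      using card_kernel_span_chains[OF vs _ \<psi>(1)] Cons.prems by (simp add: card_Diff_subset)
  qed
  also have "\<dots> = card (frames \<psi>s) * ?c" by simp
  also have "\<dots> = (\<Prod>\<chi>\<in>\<Phi>. (\<Prod>j<count (mset \<psi>s) \<chi>. card (kernel \<chi>) - CARD('a) ^ (degree \<chi> * j))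
      * (if \<chi> = \<psi> then ?c else 1))"
    using Cons finite_\<Phi> \<psi> by (simp add: prod.distrib)
  also have "\<dots> = (\<Prod>\<chi>\<in>\<Phi>. \<Prod>j<count (mset (\<psi> # \<psi>s)) \<chi>. card (kernel \<chi>) - CARD('a) ^ (degree \<chi> * j))"
    by (intro prod.cong refl) auto
  finally show ?case .
qed simp

lemma card_kernel_of_full_frame:
  assumes "vs \<in> frames \<psi>s" and "set \<psi>s \<subseteq> \<Phi>" and "\<chi> \<in> \<Phi>"
    and "V \<subseteq> span (set (chains \<psi>s vs))"
  shows "card (kernel \<chi>) = CARD('a) ^ (degree \<chi> * count (mset \<psi>s) \<chi>)"
proof -
  have "span (set (chains \<psi>s vs)) = V"
    using assms span_chains_subset_V[of vs \<psi>s] by (auto simp: frames_def)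
  then show ?thesis
    using card_kernel_span_chains[OF assms(1-3)] by (simp add: kernel_def)
qed

text \<open>
  A form of the primary decomposition: the kernels of the factors generate the kernel of the product.
  If \<open>\<psi>\<close> is one factor and \<open>P\<close> the product of the others, then \<open>U\<close> contains \<open>\<psi>(T) v\<close> by induction
  and \<open>P(T) v\<close> because it lies in the kernel of \<open>\<psi>(T)\<close>. Cancelling the factors of \<open>P\<close> one at a time
  gives \<open>v \<in> U\<close>, as none of them is a multiple of \<open>\<psi>\<close>.
\<close>

lemma kernel_subset_imp_in:
  assumes U: "invariant U" and S: "S \<subseteq> \<Phi>" and ker: "\<And>\<chi>. \<chi> \<in> S \<Longrightarrow> kernel \<chi> \<subseteq> U"
    and v: "v \<in> V" "act (\<Prod>S) v = 0"
  shows "v \<in> U"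
proof -
  have "finite S" using S finite_\<Phi> finite_subset by blast
  then show ?thesis
    using S ker v
  proof (induction S arbitrary: v rule: finite_induct)
    case empty
    then show ?case using U subspace_0 by (simp add: invariant_def)
  next
    case (insert \<psi> S)
    have \<psi>: "irreducible \<psi>" using insert.prems irreducible_\<Phi> by simp
    have zero: "act (\<psi> * \<Prod>S) v = 0"
      using insert by simp
    have "act (\<Prod>S) (act \<psi> v) = 0"
      using zero by (metis act_mult mult.commute)
    then have 1: "act \<psi> v \<in> U"
      using insert act_in_invariant[OF invariant_V] by auto
    have "act (\<Prod>S) v \<in> kernel \<psi>"
      using zero insert.prems act_in_invariant[OF invariant_V] by (simp add: kernel_def act_mult)
    then have 2: "act (\<Prod>S) v \<in> U" using insert.prems by auto
    have "w \<in> U" if "act \<psi> w \<in> U" "act (\<Prod>S) w \<in> U" for w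
      using \<open>finite S\<close> \<open>\<psi> \<notin> S\<close> insert.prems(1) that
    proof (induction S arbitrary: w rule: finite_induct)
      case (insert \<chi> S)
      have "act \<psi> (act \<chi> w) \<in> U"
        using insert.prems act_in_invariant[OF U] by (metis act_commute)
      moreover have "act (\<Prod>S) (act \<chi> w) \<in> U"
        using insert by (metis act_mult mult.commute prod.insert)
      ultimately have "act \<chi> w \<in> U"
        using insert by auto
      moreover have "\<not> \<psi> dvd \<chi>"
        using insert.prems non_associated_\<Phi>[of \<psi> \<chi>] by auto
      ultimately show ?case
        using irreducible_dvd_conductor[OF U \<psi>] insert.prems by blast
    qed simp
    then show "v \<in> U" using 1 2 by blast
  qed
qed

text \<open>
  A longest frame does it. Each of the kernels is contained in its span, for otherwise the frame could
  be prolonged, and the kernels generate \<open>V\<close>.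
\<close>

theorem ex_full_frame:
  assumes "\<And>v. v \<in> V \<Longrightarrow> act (\<Prod>\<Phi>) v = 0"
  obtains \<psi>s vs where "set \<psi>s \<subseteq> \<Phi>" "vs \<in> frames \<psi>s" "span (set (chains \<psi>s vs)) = V"
proof -
  let ?P = "\<lambda>\<psi>s. set \<psi>s \<subseteq> \<Phi> \<and> frames \<psi>s \<noteq> {}"
  have bound: "length \<psi>s < Suc (card V)" if P: "?P \<psi>s" for \<psi>s
  proof -
    obtain vs where vs: "vs \<in> frames \<psi>s" using P by auto
    have "length \<psi>s = (\<Sum>\<psi>\<leftarrow>\<psi>s. 1)" by (simp add: sum_list_triv)
    also have "\<dots> \<le> sum_list (map degree \<psi>s)"
    proof (rule sum_list_mono)
      fix \<psi> assume "\<psi> \<in> set \<psi>s"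
      then have "irreducible \<psi>" using P irreducible_\<Phi> by auto
      then have "degree \<psi> \<noteq> 0" by (metis irreducible_def is_unit_iff_degree)
      then show "1 \<le> degree \<psi>" by simp
    qed
    also have "\<dots> = card (set (chains \<psi>s vs))"
      using vs length_chains_frames[OF vs] by (simp add: frames_def distinct_card)
    also have "\<dots> \<le> card V"
      using vs set_chains_subset_V finite_V by (intro card_mono) (auto simp: frames_def)
    finally show ?thesis by simp
  qed
  have "?P []" by simp
  then obtain \<psi>s where P: "?P \<psi>s" and max: "\<And>\<psi>s'. ?P \<psi>s' \<Longrightarrow> length \<psi>s' \<le> length \<psi>s"
    using ex_has_greatest_nat[of ?P "[]" length "Suc (card V)"] bound less_imp_le by metis
  then obtain vs where vs: "vs \<in> frames \<psi>s" by auto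
  let ?U = "span (set (chains \<psi>s vs))"
  have U: "invariant ?U"
    using vs P by (intro invariant_span_chains zero_notin_\<Phi>) (auto simp: frames_def)
  have ker: "kernel \<chi> \<subseteq> ?U" if "\<chi> \<in> \<Phi>" for \<chi>
  proof
    fix v assume v: "v \<in> kernel \<chi>"
    show "v \<in> ?U"
    proof (rule ccontr)
      assume "v \<notin> ?U"
      then have "v # vs \<in> frames (\<chi> # \<psi>s)"
        using v vs that P Cons_in_frames_iff[of \<chi> \<psi>s v vs] irreducible_\<Phi> zero_notin_\<Phi>
        by (auto simp: kernel_def)
      then have "length (\<chi> # \<psi>s) \<le> length \<psi>s"
        using P that by (intro max) auto
      then show False by simp
    qed
  qed
  have "V \<subseteq> ?U"
    using kernel_subset_imp_in[OF U order_refl ker] assms by blast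
  then have "?U = V"
    using vs span_chains_subset_V[of vs \<psi>s] by (auto simp: frames_def)
  then show ?thesis using that P vs by blast
qed

end

section \<open>Matrices as operators on polynomials of bounded degree\<close>

interpretation poly_space: finite_field_space "Polynomial.smult :: 'a::finite_field \<Rightarrow> 'a poly \<Rightarrow> 'a poly"
  by unfold_locales (simp_all add: smult_add_right smult_add_left)

text \<open>
  The space \<open>K^n\<close> is represented by the polynomials of degree less than \<open>n\<close>, with the coefficients as
  coordinates. For all \<open>n\<close> together these lie in one type that is a vector space over \<open>K\<close>, so linear
  algebra applies without a carrier for each \<open>n\<close>. They are not to be confused with the
  polynomials in the operator.
\<close>

definition vecs :: "nat \<Rightarrow> 'a::finite_field poly set" where
  "vecs n = {p. \<forall>i\<ge>n. coeff p i = 0}"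

lemma subspace_vecs: "poly_space.subspace (vecs n)"
  by (rule poly_space.subspaceI) (auto simp: vecs_def)

lemma monom_in_vecs: "j < n \<Longrightarrow> monom c j \<in> vecs n"
  by (simp add: vecs_def)

lemma card_vecs: "finite (vecs n :: 'a::finite_field poly set) \<and> card (vecs n :: 'a poly set) = CARD('a) ^ n"
proof (induction n)
  case 0
  have "vecs 0 = {0 :: 'a poly}"
    by (auto simp: vecs_def poly_eq_iff)
  then show ?case by simp
next
  case (Suc n)
  let ?V = "vecs n :: 'a poly set" and ?x = "monom 1 n :: 'a poly"
  have span: "poly_space.span ?V = ?V"
    by (simp add: subspace_vecs)
  have "poly_space.span (insert ?x ?V) = vecs (Suc n)"
  proof (intro equalityI subsetI)
    fix p assume "p \<in> poly_space.span (insert ?x ?V)"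
    then obtain c where "p - Polynomial.smult c ?x \<in> ?V"
      using span by (auto simp: poly_space.span_breakdown_eq simp del: poly_space.span_eq_iff)
    then show "p \<in> vecs (Suc n)"
      by (auto simp: vecs_def)
  next
    fix p :: "'a poly" assume p: "p \<in> vecs (Suc n)"
    have "p - Polynomial.smult (coeff p n) ?x \<in> ?V"
      unfolding vecs_def
    proof (intro CollectI allI impI)
      fix i assume "n \<le> i"
      then show "coeff (p - Polynomial.smult (coeff p n) ?x) i = 0"
        using p by (cases "i = n") (auto simp: vecs_def)
    qed
    then show "p \<in> poly_space.span (insert ?x ?V)"
      using span by (auto simp: poly_space.span_breakdown_eq simp del: poly_space.span_eq_iff)
  qed
  moreover have "?x \<notin> poly_space.span ?V"
    unfolding span by (auto simp: vecs_def)
  ultimately have *: "card (vecs (Suc n) :: 'a poly set) = CARD('a) ^ Suc n"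
    using poly_space.card_span_insert[of ?x ?V] Suc span by simp
  moreover have "CARD('a) ^ Suc n > 0" by simp
  ultimately show ?case using card_ge_0_finite by metis
qed

text \<open>
  Coordinates from \<open>n\<close> on are ignored, which makes the operator linear on all polynomials.
\<close>

definition mat_op :: "nat \<Rightarrow> 'a::finite_field mat \<Rightarrow> 'a poly \<Rightarrow> 'a poly" where
  "mat_op n A p = (\<Sum>j<n. Polynomial.smult (coeff p j) (\<Sum>i<n. monom (A $$ (i, j)) i))"

lemma coeff_mat_op:
  "coeff (mat_op n A p) i = (if i < n then \<Sum>j<n. A $$ (i, j) * coeff p j else 0)"
  by (auto simp: mat_op_def coeff_sum mult.commute)

lemma mat_op_in_vecs: "mat_op n A p \<in> vecs n"
  by (simp add: vecs_def coeff_mat_op)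

lemma operator_on_mat_op: "operator_on Polynomial.smult (mat_op n A) (vecs n)"
proof
  show "mat_op n A (u + v) = mat_op n A u + mat_op n A v" for u v
    by (rule poly_eqI) (simp add: coeff_mat_op distrib_left sum.distrib)
  show "mat_op n A (Polynomial.smult c v) = Polynomial.smult c (mat_op n A v)" for c v
    by (rule poly_eqI) (simp add: coeff_mat_op sum_distrib_left mult.left_commute)
qed (simp_all add: subspace_vecs card_vecs mat_op_in_vecs)

lemma mat_op_mult:
  assumes "A \<in> carrier_mat n n" and "B \<in> carrier_mat n n"
  shows "mat_op n (A * B) p = mat_op n A (mat_op n B p)"
proof (rule poly_eqI)
  fix i
  show "coeff (mat_op n (A * B) p) i = coeff (mat_op n A (mat_op n B p)) i"
  proof (cases "i < n")
    case True
    have "coeff (mat_op n (A * B) p) i = (\<Sum>j<n. \<Sum>l<n. A $$ (i, l) * B $$ (l, j) * coeff p j)"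
      using True assms
      by (auto simp: coeff_mat_op scalar_prod_def sum_distrib_right atLeast0LessThan intro!: sum.cong)
    also have "\<dots> = (\<Sum>l<n. \<Sum>j<n. A $$ (i, l) * B $$ (l, j) * coeff p j)"
      by (rule sum.swap)
    finally show ?thesis
      using True by (simp add: coeff_mat_op sum_distrib_left mult.assoc)
  qed (simp add: coeff_mat_op)
qed

lemma mat_op_one:
  assumes "p \<in> vecs n"
  shows "mat_op n (1\<^sub>m n) p = p"
proof (rule poly_eqI)
  fix i
  have "(\<Sum>j<n. 1\<^sub>m n $$ (i, j) * coeff p j) = (\<Sum>j<n. if i = j then coeff p j else 0)" if "i < n"
    using that by (intro sum.cong) auto
  then show "coeff (mat_op n (1\<^sub>m n) p) i = coeff p i"
    using assms by (auto simp: coeff_mat_op vecs_def)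
qed

lemma mat_op_pow:
  assumes "A \<in> carrier_mat n n" and "p \<in> vecs n"
  shows "mat_op n (A ^\<^sub>m k) p = (mat_op n A ^^ k) p"
  using assms(2)
proof (induction k arbitrary: p)
  case 0
  then show ?case using assms by (simp add: mat_op_one)
next
  case (Suc k)
  then show ?case
    using assms(1) by (simp add: mat_op_mult pow_carrier_mat mat_op_in_vecs funpow_swap1)
qed

lemma mat_op_inject:
  assumes "A \<in> carrier_mat n n" and "B \<in> carrier_mat n n"
    and "\<And>p. p \<in> vecs n \<Longrightarrow> mat_op n A p = mat_op n B p"
  shows "A = B"
proof (rule eq_matI)
  fix i j assume ij: "i < dim_row B" "j < dim_col B"
  then have n: "i < n" "j < n" using assms by auto
  have entry: "coeff (mat_op n C (monom 1 j)) i = C $$ (i, j)" for C :: "'a mat"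
  proof -
    have "coeff (mat_op n C (monom 1 j)) i = (\<Sum>l<n. if l = j then C $$ (i, l) else 0)"
      using n by (auto simp: coeff_mat_op if_distrib cong: if_cong)
    then show ?thesis using n by simp
  qed
  show "A $$ (i, j) = B $$ (i, j)"
    using assms(3)[OF monom_in_vecs[OF n(2)], of 1] entry by metis
qed (use assms in auto)

lemma mat_pow_eq_one_iff:
  assumes "A \<in> carrier_mat n n"
  shows "A ^\<^sub>m k = 1\<^sub>m n \<longleftrightarrow> (\<forall>p\<in>vecs n. (mat_op n A ^^ k) p = p)"
proof
  assume "A ^\<^sub>m k = 1\<^sub>m n"
  then show "\<forall>p\<in>vecs n. (mat_op n A ^^ k) p = p"
    using assms by (auto simp flip: mat_op_pow simp: mat_op_one)
next
  assume "\<forall>p\<in>vecs n. (mat_op n A ^^ k) p = p"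
  then show "A ^\<^sub>m k = 1\<^sub>m n"
    using assms by (intro mat_op_inject[of _ n]) (auto simp: mat_op_pow mat_op_one pow_carrier_mat)
qed

lemma ex_matrix_of_linear:
  fixes g :: "'a::finite_field poly \<Rightarrow> 'a poly"
  assumes g: "Vector_Spaces.linear Polynomial.smult Polynomial.smult g"
    and V: "\<And>p. p \<in> vecs n \<Longrightarrow> g p \<in> vecs n"
  obtains A where "A \<in> carrier_mat n n" and "\<And>p. p \<in> vecs n \<Longrightarrow> mat_op n A p = g p"
proof
  interpret g: Vector_Spaces.linear Polynomial.smult Polynomial.smult g by (rule g)
  define A where "A = mat n n (\<lambda>(i, j). coeff (g (monom 1 j)) i)"
  show "A \<in> carrier_mat n n" by (simp add: A_def)
  fix p :: "'a poly" assume p: "p \<in> vecs n"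
  have "p = (\<Sum>j<n. Polynomial.smult (coeff p j) (monom 1 j))"
    using p by (intro poly_eqI) (auto simp: coeff_sum vecs_def not_less if_distrib cong: if_cong)
  then have gp: "g p = (\<Sum>j<n. Polynomial.smult (coeff p j) (g (monom 1 j)))"
    by (metis (no_types, lifting) g.scale g.sum sum.cong)
  show "mat_op n A p = g p"
  proof (rule poly_eqI)
    fix i
    show "coeff (mat_op n A p) i = coeff (g p) i"
    proof (cases "i < n")
      case True
      then show ?thesis
        unfolding gp by (simp add: coeff_mat_op A_def coeff_sum mult.commute)
    next
      case False
      then show ?thesis using V[OF p] by (simp add: coeff_mat_op vecs_def)
    qed
  qed
qed

lemma finite_carrier_mat: "finite (carrier_mat n n :: 'a::finite mat set)"
proof (rule finite_subset)
  show "carrier_mat n n \<subseteq> mat n n ` (({..<n} \<times> {..<n}) \<rightarrow>\<^sub>E (UNIV :: 'a set))"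
  proof
    fix A :: "'a mat" assume "A \<in> carrier_mat n n"
    then have "A = mat n n (restrict (\<lambda>ij. A $$ ij) ({..<n} \<times> {..<n}))"
      by (intro eq_matI) auto
    then show "A \<in> mat n n ` (({..<n} \<times> {..<n}) \<rightarrow>\<^sub>E UNIV)"
      by auto
  qed
  show "finite (mat n n ` (({..<n} \<times> {..<n}) \<rightarrow>\<^sub>E (UNIV :: 'a set)))"
    by (intro finite_imageI finite_PiE) auto
qed

section \<open>Frames of matrices and ordered bases\<close>

definition ordered_bases :: "nat \<Rightarrow> 'a::finite_field poly list set" where
  "ordered_bases n = {ws. length ws = n \<and> set ws \<subseteq> vecs n \<and> distinct ws \<and> poly_space.independent (set ws)}"

text \<open>
  Ordered bases are the frames of the zero operator for the list \<open>z, \<dots>, z\<close>: the chains have length one,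
  and every vector is in the kernel.
\<close>

lemma card_ordered_bases:
  "card (ordered_bases n :: 'a::finite_field poly list set) = (\<Prod>j<n. CARD('a) ^ n - CARD('a) ^ j)"
proof -
  let ?z = "[:0, 1:] :: 'a poly"
  interpret operator_with_primes Polynomial.smult "\<lambda>_. 0" "vecs n" "{?z}"
    by unfold_locales
       (auto simp: subspace_vecs card_vecs poly_space.subspace_0 intro!: irreducible_linear_field_poly)
  have act: "act ?z v = 0" for v
    by (simp add: act_pCons)
  have chains: "chains (replicate m ?z) vs = vs" if "length vs = m" for m vs
    using that by (induction m arbitrary: vs) (auto simp: length_Suc_conv)
  have "frames (replicate n ?z) = ordered_bases n"
    using chains act by (auto simp: frames_def ordered_bases_def list_all2_conv_all_nth)
  moreover have "kernel ?z = vecs n"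
    by (simp add: kernel_def act)
  moreover have "set (replicate n ?z) \<subseteq> {?z}"
    by auto
  ultimately show ?thesis
    using card_frames[of "replicate n ?z"] card_vecs[of n, where 'a = 'a] by simp
qed

lemma span_ordered_basis:
  fixes ws :: "'a::finite_field poly list"
  assumes "ws \<in> ordered_bases n"
  shows "poly_space.span (set ws) = vecs n"
proof (rule card_subset_eq)
  show "poly_space.span (set ws) \<subseteq> vecs n"
    using assms subspace_vecs by (intro poly_space.span_minimal) (auto simp: ordered_bases_def)
  show "card (poly_space.span (set ws)) = card (vecs n :: 'a poly set)"
    using assms poly_space.card_span_basis[of ws] card_vecs[of n, where 'a='a]
    by (simp add: ordered_bases_def)
qed (simp add: card_vecs)

abbreviation "mat_frames n A \<equiv> operator_on.frames Polynomial.smult (mat_op n A) (vecs n)"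
abbreviation "mat_chains n A \<equiv> operator_on.chains (mat_op n A)"

text \<open>
  Summing over all matrices counts the pairs of a matrix and a frame. Such a pair is determined by the
  basis that its chains form, and every ordered basis arises.
\<close>

theorem sum_card_mat_frames:
  fixes \<psi>s :: "'a::finite_field poly list"
  assumes pos: "\<And>\<psi>. \<psi> \<in> set \<psi>s \<Longrightarrow> degree \<psi> > 0" and n: "sum_list (map degree \<psi>s) = n"
  shows "(\<Sum>A\<in>carrier_mat n n. card (mat_frames n A \<psi>s)) = (\<Prod>j<n. CARD('a) ^ n - CARD('a) ^ j)"
proof -
  let ?S = "Sigma (carrier_mat n n) (\<lambda>A. mat_frames n A \<psi>s)"
  let ?f = "\<lambda>(A, vs). mat_chains n A \<psi>s vs"
  have iff: "vs \<in> mat_frames n A \<psi>s \<and> mat_chains n A \<psi>s vs = ws \<longleftrightarrow>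
      ws \<in> ordered_bases n \<and> vs = poly_space.heads \<psi>s ws \<and> map (mat_op n A) ws = poly_space.images \<psi>s ws"
    if "A \<in> carrier_mat n n" for A :: "'a mat" and vs ws
  proof -
    interpret operator_on Polynomial.smult "mat_op n A" "vecs n"
      by (rule operator_on_mat_op)
    show ?thesis
    proof
      assume L: "vs \<in> frames \<psi>s \<and> chains \<psi>s vs = ws"
      then have "ws \<in> ordered_bases n"
        using set_chains_subset_V[of vs \<psi>s] length_chains_frames[of vs \<psi>s] n
        by (auto simp: frames_def ordered_bases_def)
      then show "ws \<in> ordered_bases n \<and> vs = poly_space.heads \<psi>s ws \<and>
          map (mat_op n A) ws = poly_space.images \<psi>s ws"
        using L chains_iff[OF pos, of \<psi>s ws vs] n by (auto simp: frames_def ordered_bases_def)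
    next
      assume R: "ws \<in> ordered_bases n \<and> vs = poly_space.heads \<psi>s ws \<and>
          map (mat_op n A) ws = poly_space.images \<psi>s ws"
      then have "set vs \<subseteq> vecs n"
        using poly_space.set_heads_subset[OF pos, of \<psi>s ws] n by (auto simp: ordered_bases_def)
      then show "vs \<in> frames \<psi>s \<and> chains \<psi>s vs = ws"
        using R chains_iff[OF pos, of \<psi>s ws vs] n by (auto simp: frames_def ordered_bases_def)
    qed
  qed
  have inj: "inj_on ?f ?S"
  proof (rule inj_onI, clarify)
    fix A B :: "'a mat" and vs us
    assume A: "A \<in> carrier_mat n n" "vs \<in> mat_frames n A \<psi>s"
      and B: "B \<in> carrier_mat n n" "us \<in> mat_frames n B \<psi>s"
      and eq: "mat_chains n A \<psi>s vs = mat_chains n B \<psi>s us"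
    define ws where "ws = mat_chains n A \<psi>s vs"
    have ws: "ws \<in> ordered_bases n" "vs = poly_space.heads \<psi>s ws"
        "map (mat_op n A) ws = poly_space.images \<psi>s ws"
      using iff[OF A(1), of vs ws] A(2) by (auto simp: ws_def)
    moreover have "us = poly_space.heads \<psi>s ws" "map (mat_op n B) ws = poly_space.images \<psi>s ws"
      using iff[OF B(1), of us ws] B(2) eq by (auto simp: ws_def)
    ultimately have agree: "mat_op n A w = mat_op n B w" if "w \<in> set ws" for w
      using that by (metis map_eq_conv)
    interpret A: operator_on Polynomial.smult "mat_op n A" "vecs n" by (rule operator_on_mat_op)
    interpret B: operator_on Polynomial.smult "mat_op n B" "vecs n" by (rule operator_on_mat_op)
    have "poly_space.subspace {p. mat_op n A p = mat_op n B p}"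
      by (rule poly_space.subspaceI) (auto simp: A.T_0 B.T_0 A.T_add B.T_add A.T_scale B.T_scale)
    then have "poly_space.span (set ws) \<subseteq> {p. mat_op n A p = mat_op n B p}"
      using agree by (intro poly_space.span_minimal) auto
    then have "A = B"
      using span_ordered_basis[OF ws(1)] A(1) B(1) by (intro mat_op_inject[of A n B]) auto
    then show "A = B \<and> vs = us"
      using ws(2) \<open>us = poly_space.heads \<psi>s ws\<close> by simp
  qed
  have "?f ` ?S = ordered_bases n"
  proof (intro equalityI subsetI)
    fix ws assume "ws \<in> ?f ` ?S"
    then show "ws \<in> ordered_bases n" using iff by auto
  next
    fix ws :: "'a poly list" assume ws: "ws \<in> ordered_bases n"
    have len: "length ws = sum_list (map degree \<psi>s)"
      using ws n by (simp add: ordered_bases_def)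
    let ?im = "poly_space.images \<psi>s ws"
    interpret pair: vector_space_pair "Polynomial.smult :: 'a \<Rightarrow> _" "Polynomial.smult :: 'a \<Rightarrow> _"
      by unfold_locales
    have ind: "poly_space.independent (set ws)" "distinct ws"
      using ws by (auto simp: ordered_bases_def)
    define h where "h w = the (map_of (zip ws ?im) w)" for w
    define g where "g = pair.construct (set ws) h"
    have lin: "Vector_Spaces.linear Polynomial.smult Polynomial.smult g"
      unfolding g_def using ind(1) by (rule pair.linear_construct)
    have "h (ws ! i) = ?im ! i" if "i < length ws" for i
      using that ind poly_space.length_images[OF pos len] by (simp add: h_def map_of_zip_nth)
    then have map_h: "map h ws = ?im"
      using poly_space.length_images[OF pos len] by (intro nth_equalityI) auto
    have map_g: "map g ws = ?im"
      unfolding map_h[symmetric] g_def using ind by (auto intro!: pair.construct_basis)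
    have "h ` set ws \<subseteq> vecs n"
      using poly_space.set_images_subset[OF subspace_vecs _ pos len, of n] ws map_h
      by (metis (no_types, lifting) ordered_bases_def mem_Collect_eq set_map)
    then have "g p \<in> vecs n" for p
      unfolding g_def
      using pair.construct_in_span[OF ind(1), of h p] poly_space.span_minimal[OF _ subspace_vecs] by blast
    then obtain A where A: "A \<in> carrier_mat n n" "\<And>p. p \<in> vecs n \<Longrightarrow> mat_op n A p = g p"
      using ex_matrix_of_linear[OF lin, of n] by blast
    then have "map (mat_op n A) ws = ?im"
      unfolding map_g[symmetric] using ws by (auto simp: ordered_bases_def)
    then show "ws \<in> ?f ` ?S"
      using iff[OF A(1), of "poly_space.heads \<psi>s ws" ws] ws A(1)
      by (intro image_eqI[of _ _ "(A, poly_space.heads \<psi>s ws)"]) auto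
  qed
  then have "card ?S = card (ordered_bases n :: 'a poly list set)"
    using card_image[OF inj] by simp
  moreover have "card ?S = (\<Sum>A\<in>carrier_mat n n. card (mat_frames n A \<psi>s))"
    using finite_carrier_mat operator_on.finite_frames[OF operator_on_mat_op]
    by (intro card_SigmaI) auto
  ultimately show ?thesis by (simp add: card_ordered_bases)
qed

section \<open>Square factors of \<open>z^k - 1\<close>\<close>

lemma irreducible_poly_degree_pos:
  fixes \<psi> :: "'a::field poly"
  assumes "irreducible \<psi>"
  shows "degree \<psi> > 0"
proof -
  have "degree \<psi> \<noteq> 0" using assms by (metis irreducible_def is_unit_iff_degree)
  then show ?thesis by simp
qed

text \<open>
  The translation by \<open>1\<close> permutes the ring, so it does not change the sum of all elements, although it
  adds \<open>1\<close> to each of them.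
\<close>

lemma of_nat_card_eq_0: "of_nat CARD('a) = (0 :: 'a::{ring_1,finite})"
proof -
  have "(\<Sum>x::'a\<in>UNIV. x) = (\<Sum>x\<in>UNIV. x + 1)"
    by (rule sum.reindex_bij_witness[of _ "\<lambda>x. x + 1" "\<lambda>x. x - 1"]) auto
  then show ?thesis by (simp add: sum.distrib)
qed

text \<open>
  If \<open>\<psi>^2\<close> divides \<open>f = z^k - 1\<close>, then \<open>\<psi>\<close> divides both \<open>f\<close> and its derivative, hence also the unit
  \<open>z f' - k f = k\<close>.
\<close>

lemma not_square_dvd_X_pow_minus_one:
  fixes \<psi> :: "'a::field poly"
  assumes \<psi>: "irreducible \<psi>" and k: "of_nat k \<noteq> (0 :: 'a)"
  shows "\<not> \<psi> * \<psi> dvd monom 1 k - 1"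
proof
  let ?f = "monom 1 k - 1 :: 'a poly"
  assume "\<psi> * \<psi> dvd ?f"
  then obtain g where g: "?f = \<psi> * \<psi> * g" by (auto simp: dvd_def)
  have "pderiv ?f = \<psi> * (pderiv (\<psi> * g) + pderiv \<psi> * g)"
    unfolding g by (simp add: pderiv_mult algebra_simps)
  then have "\<psi> dvd pderiv ?f" by simp
  moreover have "k > 0" using k by (cases k) auto
  then have "monom 1 1 * pderiv ?f - of_nat k * ?f = [:of_nat k:]"
    by (simp add: pderiv_diff pderiv_monom mult_monom algebra_simps of_nat_poly smult_monom)
  moreover have "\<psi> dvd ?f" unfolding g by (simp add: mult.assoc)
  ultimately have "\<psi> dvd [:of_nat k:]"
    by (metis dvd_diff dvd_mult)
  then have "degree \<psi> \<le> degree [:of_nat k :: 'a:]"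
    using k by (intro dvd_imp_degree_le) auto
  then show False using irreducible_poly_degree_pos[OF \<psi>] by simp
qed

section \<open>Coefficients of the product of power series\<close>

text \<open>
  A multiset \<open>M\<close> of polynomials stands for the isomorphism type of the module that is the direct sum of the
  \<open>K[z]/(\<chi>)\<close> with \<open>\<chi>\<close> in \<open>M\<close>; the sum is its dimension over \<open>K\<close>.
\<close>

definition poly_types :: "'a::zero poly set \<Rightarrow> nat \<Rightarrow> 'a poly multiset set" where
  "poly_types \<Phi> n = {M. set_mset M \<subseteq> \<Phi> \<and> (\<Sum>\<chi>\<in>\<Phi>. degree \<chi> * count M \<chi>) = n}"

lemma sum_list_degree_eq:
  fixes \<psi>s :: "'a::zero poly list"
  assumes "finite \<Phi>" and "set \<psi>s \<subseteq> \<Phi>"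
  shows "sum_list (map degree \<psi>s) = (\<Sum>\<chi>\<in>\<Phi>. degree \<chi> * count (mset \<psi>s) \<chi>)"
  using assms(2)
proof (induction \<psi>s)
  case (Cons \<psi> \<psi>s)
  have "(\<Sum>\<chi>\<in>\<Phi>. degree \<chi> * count (mset (\<psi> # \<psi>s)) \<chi>) =
      (\<Sum>\<chi>\<in>\<Phi>. degree \<chi> * count (mset \<psi>s) \<chi> + (if \<chi> = \<psi> then degree \<psi> else 0))"
    by (intro sum.cong) auto
  also have "\<dots> = sum_list (map degree \<psi>s) + degree \<psi>"
    using Cons assms(1) by (simp add: sum.distrib)
  finally show ?case by simp
qed simp

lemma fps_nth_compose_X_power:
  assumes "d > 0"
  shows "(Abs_fps c oo fps_X ^ d) $ i = (if d dvd i then c (i div d) else (0 :: 'a::comm_ring_1))"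
proof -
  have "(Abs_fps c oo fps_X ^ d) $ i = (\<Sum>m\<in>{0..i}. if i = m * d then c m else 0)"
    by (simp add: fps_compose_nth power_mult[symmetric] mult.commute if_distrib cong: if_cong)
  also have "\<dots> = (\<Sum>m\<in>{0..i}. if m = i div d then if d dvd i then c (i div d) else 0 else 0)"
    using assms by (intro sum.cong refl) auto
  also have "\<dots> = (if d dvd i then c (i div d) else 0)"
    by (simp add: sum.delta)
  finally show ?thesis .
qed

text \<open>
  In the general product of power series the exponents form a multiset of size \<open>n\<close> over the index set.
  Only those with exponents divisible by the degrees contribute here, and dividing by the degrees
  turns them into types.
\<close>

lemma fps_nth_prod_compose_X_power:
  fixes c :: "'a::zero poly \<Rightarrow> nat \<Rightarrow> 'b::comm_ring_1"
  assumes fin: "finite \<Phi>" and pos: "\<And>\<chi>. \<chi> \<in> \<Phi> \<Longrightarrow> degree \<chi> > 0"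
  shows "finite (poly_types \<Phi> n)"
    and "(\<Prod>\<chi>\<in>\<Phi>. Abs_fps (c \<chi>) oo fps_X ^ degree \<chi>) $ n =
      (\<Sum>M\<in>poly_types \<Phi> n. \<Prod>\<chi>\<in>\<Phi>. c \<chi> (count M \<chi>))"
proof -
  define scale where "scale M = (\<Sum>\<chi>\<in>\<Phi>. replicate_mset (degree \<chi> * count M \<chi>) \<chi>)" for M
  have count_scale: "count (scale M) \<chi> = (if \<chi> \<in> \<Phi> then degree \<chi> * count M \<chi> else 0)" for M \<chi>
    using fin by (simp add: scale_def count_sum)
  have inj: "inj_on scale (poly_types \<Phi> n)"
  proof (intro inj_onI multiset_eqI)
    fix M N \<chi> assume M: "M \<in> poly_types \<Phi> n" "N \<in> poly_types \<Phi> n" "scale M = scale N"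
    show "count M \<chi> = count N \<chi>"
    proof (cases "\<chi> \<in> \<Phi>")
      case True
      then have "degree \<chi> * count M \<chi> = degree \<chi> * count N \<chi>"
        using count_scale[of M \<chi>] count_scale[of N \<chi>] M(3) by metis
      then show ?thesis using pos[OF True] by simp
    next
      case False
      then have "\<chi> \<notin># M" "\<chi> \<notin># N" using M by (auto simp: poly_types_def)
      then show ?thesis by (simp add: not_in_iff)
    qed
  qed
  have size: "size X = (\<Sum>\<chi>\<in>\<Phi>. count X \<chi>)" if "set_mset X \<subseteq> \<Phi>" for X
    unfolding size_multiset_overloaded_eq using that fin
    by (intro sum.mono_neutral_left) (auto simp: not_in_iff)
  have set_scale: "set_mset (scale M) \<subseteq> \<Phi>" for M
    using count_scale[of M] by (metis count_eq_zero_iff subsetI)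
  have image: "scale ` poly_types \<Phi> n = {X \<in> multisets_of_size \<Phi> n. \<forall>\<chi>\<in>\<Phi>. degree \<chi> dvd count X \<chi>}"
  proof (intro equalityI subsetI)
    fix X assume "X \<in> scale ` poly_types \<Phi> n"
    then show "X \<in> {X \<in> multisets_of_size \<Phi> n. \<forall>\<chi>\<in>\<Phi>. degree \<chi> dvd count X \<chi>}"
      using set_scale size[OF set_scale] by (auto simp: multisets_of_size_def poly_types_def count_scale)
  next
    fix X assume "X \<in> {X \<in> multisets_of_size \<Phi> n. \<forall>\<chi>\<in>\<Phi>. degree \<chi> dvd count X \<chi>}"
    then have X: "set_mset X \<subseteq> \<Phi>" "size X = n" "\<And>\<chi>. \<chi> \<in> \<Phi> \<Longrightarrow> degree \<chi> dvd count X \<chi>"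
      by (auto simp: multisets_of_size_def)
    define M where "M = (\<Sum>\<chi>\<in>\<Phi>. replicate_mset (count X \<chi> div degree \<chi>) \<chi>)"
    have count_M: "count M \<chi> = (if \<chi> \<in> \<Phi> then count X \<chi> div degree \<chi> else 0)" for \<chi>
      using fin by (simp add: M_def count_sum)
    have "scale M = X"
    proof (rule multiset_eqI)
      fix \<chi> show "count (scale M) \<chi> = count X \<chi>"
        using X by (auto simp: count_scale count_M not_in_iff[symmetric])
    qed
    moreover have "set_mset M \<subseteq> \<Phi>"
      using count_M by (metis count_eq_zero_iff subsetI)
    moreover have "(\<Sum>\<chi>\<in>\<Phi>. degree \<chi> * count M \<chi>) = n"
      using X size[OF X(1)] by (simp add: count_M)
    ultimately show "X \<in> scale ` poly_types \<Phi> n"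
      by (auto simp: poly_types_def)
  qed
  have fin_ms: "finite (multisets_of_size \<Phi> n)"
    using fin by (rule finite_multisets_of_size)
  then have "finite (scale ` poly_types \<Phi> n)" unfolding image by simp
  then show "finite (poly_types \<Phi> n)" using inj by (rule finite_imageD)
  let ?F = "\<lambda>\<chi>. Abs_fps (c \<chi>) oo fps_X ^ degree \<chi>"
  have F: "?F \<chi> $ i = (if degree \<chi> dvd i then c \<chi> (i div degree \<chi>) else 0)" if "\<chi> \<in> \<Phi>" for \<chi> i
    using pos[OF that] by (rule fps_nth_compose_X_power)
  have "(\<Prod>\<chi>\<in>\<Phi>. ?F \<chi>) $ n = (\<Sum>X\<in>multisets_of_size \<Phi> n. \<Prod>\<chi>\<in>\<Phi>. ?F \<chi> $ count X \<chi>)"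
    using fin by (rule fps_prod_nth')
  also have "\<dots> = (\<Sum>X\<in>scale ` poly_types \<Phi> n. \<Prod>\<chi>\<in>\<Phi>. ?F \<chi> $ count X \<chi>)"
    unfolding image using fin_ms fin F
    by (intro sum.mono_neutral_right) (auto intro!: prod_zero)
  also have "\<dots> = (\<Sum>M\<in>poly_types \<Phi> n. \<Prod>\<chi>\<in>\<Phi>. ?F \<chi> $ count (scale M) \<chi>)"
    by (simp add: sum.reindex[OF inj])
  also have "\<dots> = (\<Sum>M\<in>poly_types \<Phi> n. \<Prod>\<chi>\<in>\<Phi>. c \<chi> (count M \<chi>))"
  proof (intro sum.cong prod.cong refl)
    fix M \<chi> assume "\<chi> \<in> \<Phi>"
    then show "?F \<chi> $ count (scale M) \<chi> = c \<chi> (count M \<chi>)"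
      using F pos[of \<chi>] by (simp add: count_scale)
  qed
  finally show "(\<Prod>\<chi>\<in>\<Phi>. ?F \<chi>) $ n = (\<Sum>M\<in>poly_types \<Phi> n. \<Prod>\<chi>\<in>\<Phi>. c \<chi> (count M \<chi>))" .
qed

section \<open>Matrices of finite order by type\<close>

lemma GL_order_eq_of_nat:
  assumes "Q > 1"
  shows "GL_order m Q = of_nat (\<Prod>j<m. Q ^ m - Q ^ j)"
    and "GL_order m Q \<noteq> 0"
proof -
  have less: "Q ^ j < Q ^ m" if "j < m" for j
    using assms that by (intro power_strict_increasing) auto
  then show eq: "GL_order m Q = of_nat (\<Prod>j<m. Q ^ m - Q ^ j)"
    unfolding GL_order_def of_nat_prod
    by (intro prod.cong refl) (simp add: of_nat_diff less_imp_le)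
  have "(\<Prod>j<m. Q ^ m - Q ^ j) \<noteq> 0"
    using less by (simp add: not_le)
  then show "GL_order m Q \<noteq> 0" unfolding eq by (simp only: of_nat_eq_0_iff not_False_eq_True)
qed

abbreviation "mat_kernel_card n A \<chi> \<equiv> card (operator_on.kernel Polynomial.smult (mat_op n A) (vecs n) \<chi>)"

text \<open>
  For irreducible \<open>\<chi>\<close> the kernel of \<open>\<chi>(A)\<close> is a vector space over \<open>K[z]/(\<chi>)\<close>; its dimension over this field is the
  multiplicity of \<open>\<chi>\<close> in the type of \<open>A\<close>.
\<close>

definition has_type :: "'a::finite_field poly set \<Rightarrow> nat \<Rightarrow> 'a mat \<Rightarrow> 'a poly multiset \<Rightarrow> bool" where
  "has_type \<Phi> n A M \<longleftrightarrow> (\<forall>\<chi>\<in>\<Phi>. mat_kernel_card n A \<chi> = CARD('a) ^ (degree \<chi> * count M \<chi>))"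

definition roots_of_one :: "nat \<Rightarrow> nat \<Rightarrow> 'a::semiring_1 mat set" where
  "roots_of_one n k = {A \<in> carrier_mat n n. A ^\<^sub>m k = 1\<^sub>m n}"

context
  fixes \<Phi> :: "'a::finite_field poly set" and k :: nat
  assumes k: "of_nat k \<noteq> (0 :: 'a)"
    and finite_\<Phi>: "finite \<Phi>" and irreducible_\<Phi>: "\<And>\<chi>. \<chi> \<in> \<Phi> \<Longrightarrow> irreducible \<chi>"
    and prod_\<Phi>: "\<Prod>\<Phi> = monom 1 k - 1"
begin

lemma operator_with_primes_mat_op: "operator_with_primes Polynomial.smult (mat_op n A) (vecs n) \<Phi>"
proof (intro operator_with_primes.intro operator_on_mat_op operator_with_primes_axioms.intro finite_\<Phi>)
  fix \<psi> \<chi> assume *: "\<psi> \<in> \<Phi>" "\<chi> \<in> \<Phi>" "\<psi> dvd \<chi>"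
  show "\<psi> = \<chi>"
  proof (rule ccontr)
    assume "\<psi> \<noteq> \<chi>"
    have "\<psi> * \<psi> dvd \<psi> * \<chi>" using * by simp
    also have "\<psi> * \<chi> = \<Prod>{\<psi>, \<chi>}" using \<open>\<psi> \<noteq> \<chi>\<close> by simp
    also have "\<dots> dvd \<Prod>\<Phi>" using * finite_\<Phi> by (intro prod_dvd_prod_subset) auto
    finally show False
      using not_square_dvd_X_pow_minus_one[OF irreducible_\<Phi> k] * by (simp add: prod_\<Phi>)
  qed
qed (rule irreducible_\<Phi>)

lemma mem_roots_of_one_iff:
  "A \<in> roots_of_one n k \<longleftrightarrow>
    A \<in> carrier_mat n n \<and> (\<forall>v\<in>vecs n. operator_on.act Polynomial.smult (mat_op n A) (\<Prod>\<Phi>) v = 0)"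
proof -
  interpret operator_on Polynomial.smult "mat_op n A" "vecs n" by (rule operator_on_mat_op)
  show ?thesis
    unfolding prod_\<Phi> by (auto simp: roots_of_one_def mat_pow_eq_one_iff act_diff_left act_monom)
qed

text \<open>
  By its cardinality the span of the chains is everything, so a polynomial kills the space if it kills the
  members of the frame, and the kernels are those inside the span of a frame.
\<close>

lemma full_frame:
  assumes A: "A \<in> carrier_mat n n" and \<psi>s: "set \<psi>s \<subseteq> \<Phi>" "sum_list (map degree \<psi>s) = n"
    and vs: "vs \<in> mat_frames n A \<psi>s"
  shows "A \<in> roots_of_one n k \<and> has_type \<Phi> n A (mset \<psi>s)"
proof -
  interpret operator_with_primes Polynomial.smult "mat_op n A" "vecs n" \<Phi>
    by (rule operator_with_primes_mat_op)
  have span: "poly_space.span (set (chains \<psi>s vs)) = vecs n"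
  proof (rule card_subset_eq)
    show "poly_space.span (set (chains \<psi>s vs)) \<subseteq> vecs n"
      using vs by (intro span_chains_subset_V) (auto simp: frames_def)
    show "card (poly_space.span (set (chains \<psi>s vs))) = card (vecs n :: 'a poly set)"
      using card_span_chains[OF vs] \<psi>s card_vecs[of n, where 'a = 'a] by simp
  qed (rule finite_V)
  have "act (\<Prod>\<Phi>) v = 0" if "v \<in> vecs n" for v
    using vs \<psi>s finite_\<Phi> span that
    by (intro act_eq_0_on_span_chains[of \<psi>s vs]) (auto simp: frames_def intro: dvd_prodI)
  then have "A \<in> roots_of_one n k" using A mem_roots_of_one_iff by blast
  moreover have "has_type \<Phi> n A (mset \<psi>s)"
    unfolding has_type_def using card_kernel_of_full_frame[OF vs \<psi>s(1)] span by simp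
  ultimately show ?thesis ..
qed

lemma card_mat_frames:
  assumes A: "A \<in> carrier_mat n n" and \<psi>s: "set \<psi>s \<subseteq> \<Phi>" "sum_list (map degree \<psi>s) = n"
  shows "card (mat_frames n A \<psi>s) =
    (if A \<in> roots_of_one n k \<and> has_type \<Phi> n A (mset \<psi>s)
     then \<Prod>\<chi>\<in>\<Phi>. \<Prod>j<count (mset \<psi>s) \<chi>. (CARD('a) ^ degree \<chi>) ^ count (mset \<psi>s) \<chi> - (CARD('a) ^ degree \<chi>) ^ j
     else 0)"
proof -
  interpret operator_with_primes Polynomial.smult "mat_op n A" "vecs n" \<Phi>
    by (rule operator_with_primes_mat_op)
  show ?thesis
  proof (cases "A \<in> roots_of_one n k \<and> has_type \<Phi> n A (mset \<psi>s)")
    case True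
    then show ?thesis
      using card_frames[OF \<psi>s(1)] by (simp add: has_type_def power_mult cong: prod.cong)
  next
    case False
    then have "frames \<psi>s = {}" using full_frame[OF assms] by blast
    then show ?thesis unfolding if_not_P[OF False] by simp
  qed
qed

lemma ex1_type:
  assumes "A \<in> roots_of_one n k"
  shows "\<exists>!M. M \<in> poly_types \<Phi> n \<and> has_type \<Phi> n A M"
proof -
  interpret operator_with_primes Polynomial.smult "mat_op n A" "vecs n" \<Phi>
    by (rule operator_with_primes_mat_op)
  obtain \<psi>s vs where *: "set \<psi>s \<subseteq> \<Phi>" "vs \<in> frames \<psi>s" "poly_space.span (set (chains \<psi>s vs)) = vecs n"
    using assms mem_roots_of_one_iff by (metis ex_full_frame)
  have q: "CARD('a) > 1"
    using card_mono[of "UNIV :: 'a set" "{0, 1}"] by simp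
  have "CARD('a) ^ sum_list (map degree \<psi>s) = CARD('a) ^ n"
    using card_span_chains[OF *(2)] *(3) card_vecs[of n, where 'a = 'a] by simp
  then have n: "sum_list (map degree \<psi>s) = n"
    using q by (simp add: power_inject_exp)
  show ?thesis
  proof (rule ex1I)
    show "mset \<psi>s \<in> poly_types \<Phi> n \<and> has_type \<Phi> n A (mset \<psi>s)"
      using full_frame[OF _ *(1) n *(2)] assms * n sum_list_degree_eq[OF finite_\<Phi> *(1)]
      by (auto simp: poly_types_def roots_of_one_def)
    fix M assume M: "M \<in> poly_types \<Phi> n \<and> has_type \<Phi> n A M"
    show "M = mset \<psi>s"
    proof (rule multiset_eqI)
      fix \<chi>
      show "count M \<chi> = count (mset \<psi>s) \<chi>"
      proof (cases "\<chi> \<in> \<Phi>")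
        case True
        have "CARD('a) ^ (degree \<chi> * count M \<chi>) = CARD('a) ^ (degree \<chi> * count (mset \<psi>s) \<chi>)"
          using M True card_kernel_of_full_frame[OF *(2,1) True] *(3) by (simp add: has_type_def)
        then have "degree \<chi> * count M \<chi> = degree \<chi> * count (mset \<psi>s) \<chi>"
          using q power_inject_exp by blast
        then show ?thesis
          using irreducible_poly_degree_pos[OF irreducible_\<Phi>[OF True]] by simp
      next
        case False
        then have "\<chi> \<notin># M" "\<chi> \<notin># mset \<psi>s" using M *(1) by (auto simp: poly_types_def)
        then show ?thesis by (metis count_eq_zero_iff)
      qed
    qed
  qed
qed

text \<open>
  For each type \<open>M\<close> the double count reads: \<open>\<gamma>_n\<close> is the number of matrices of type \<open>M\<close> times the number of
  frames of one such matrix. It remains to divide and to sum over the types.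
\<close>

lemma card_roots_of_one:
  "of_nat (card (roots_of_one n k :: 'a mat set)) / GL_order n CARD('a) =
    (\<Sum>M\<in>poly_types \<Phi> n. \<Prod>\<chi>\<in>\<Phi>. 1 / GL_order (count M \<chi>) (CARD('a) ^ degree \<chi>))"
proof -
  let ?R = "roots_of_one n k :: 'a mat set"
  have q: "CARD('a) > 1"
    using card_mono[of "UNIV :: 'a set" "{0, 1}"] by simp
  have pos: "degree \<chi> > 0" if "\<chi> \<in> \<Phi>" for \<chi>
    using that irreducible_\<Phi> by (intro irreducible_poly_degree_pos)
  have qd: "CARD('a) ^ degree \<chi> > 1" if "\<chi> \<in> \<Phi>" for \<chi>
    using one_less_power[OF q pos[OF that]] .
  note fin_types = fps_nth_prod_compose_X_power(1)[OF finite_\<Phi> pos, of n]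
  have fin_R: "finite ?R"
    using finite_carrier_mat by (rule finite_subset[rotated]) (auto simp: roots_of_one_def)
  have one: "(\<Prod>\<chi>\<in>\<Phi>. 1 / GL_order (count M \<chi>) (CARD('a) ^ degree \<chi>)) =
      of_nat (card {A \<in> ?R. has_type \<Phi> n A M}) / GL_order n CARD('a)" if M: "M \<in> poly_types \<Phi> n" for M
  proof -
    obtain \<psi>s where \<psi>s: "mset \<psi>s = M" using ex_mset by blast
    have sub: "set \<psi>s \<subseteq> \<Phi>" using M \<psi>s by (auto simp: poly_types_def)
    have n: "sum_list (map degree \<psi>s) = n"
      using M \<psi>s sum_list_degree_eq[OF finite_\<Phi> sub] by (simp add: poly_types_def)
    let ?P = "\<Prod>\<chi>\<in>\<Phi>. \<Prod>j<count M \<chi>. (CARD('a) ^ degree \<chi>) ^ count M \<chi> - (CARD('a) ^ degree \<chi>) ^ j"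
    have P: "of_nat ?P = (\<Prod>\<chi>\<in>\<Phi>. GL_order (count M \<chi>) (CARD('a) ^ degree \<chi>))"
      unfolding of_nat_prod[of _ \<Phi>] using GL_order_eq_of_nat(1)[OF qd] by (intro prod.cong refl) simp
    have "(\<Prod>j<n. CARD('a) ^ n - CARD('a) ^ j) = (\<Sum>A\<in>carrier_mat n n. card (mat_frames n A \<psi>s))"
      using sub pos n by (intro sum_card_mat_frames[symmetric]) auto
    also have "\<dots> = (\<Sum>A\<in>carrier_mat n n. if A \<in> ?R \<and> has_type \<Phi> n A M then ?P else 0)"
      using card_mat_frames[OF _ sub n] \<psi>s by (intro sum.cong) auto
    also have "\<dots> = (\<Sum>A\<in>{A \<in> ?R. has_type \<Phi> n A M}. ?P)"
      using finite_carrier_mat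
      by (intro sum.mono_neutral_cong_right) (auto simp: roots_of_one_def)
    finally have "(\<Prod>j<n. CARD('a) ^ n - CARD('a) ^ j) = card {A \<in> ?R. has_type \<Phi> n A M} * ?P"
      by simp
    then have "GL_order n CARD('a) = of_nat (card {A \<in> ?R. has_type \<Phi> n A M}) *
        (\<Prod>\<chi>\<in>\<Phi>. GL_order (count M \<chi>) (CARD('a) ^ degree \<chi>))"
      unfolding GL_order_eq_of_nat(1)[OF q] P[symmetric] by (simp only: of_nat_mult)
    moreover have "(\<Prod>\<chi>\<in>\<Phi>. GL_order (count M \<chi>) (CARD('a) ^ degree \<chi>)) \<noteq> 0"
      using GL_order_eq_of_nat(2)[OF qd] finite_\<Phi> by simp
    moreover have "GL_order n CARD('a) \<noteq> 0"
      using q by (rule GL_order_eq_of_nat(2))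
    ultimately show ?thesis
      by (simp add: prod_dividef field_simps)
  qed
  have "(\<Sum>M\<in>poly_types \<Phi> n. card {A \<in> ?R. has_type \<Phi> n A M}) = card ?R"
  proof -
    have "card ?R = card (\<Union>M\<in>poly_types \<Phi> n. {A \<in> ?R. has_type \<Phi> n A M})"
      using ex1_type by (intro arg_cong[of _ _ card]) blast
    also have "\<dots> = (\<Sum>M\<in>poly_types \<Phi> n. card {A \<in> ?R. has_type \<Phi> n A M})"
      using fin_types fin_R ex1_type by (intro card_UN_disjoint) auto
    finally show ?thesis ..
  qed
  then have "of_nat (card ?R) / GL_order n CARD('a) =
      (\<Sum>M\<in>poly_types \<Phi> n. of_nat (card {A \<in> ?R. has_type \<Phi> n A M}) / GL_order n CARD('a))"
    by (simp add: sum_divide_distrib[symmetric] flip: of_nat_sum)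
  then show ?thesis using one by simp
qed

end

section \<open>The generating function\<close>

theorem theorem16:
  fixes q k r :: nat
    and \<phi> :: "nat \<Rightarrow> 'a :: finite_field poly"
    and d :: "nat \<Rightarrow> nat"
    and a :: "nat \<Rightarrow> nat"
  assumes "primepow q" and "CARD('a) = q"
    and "k > 0" and "coprime k q"
    and "monom 1 k - 1 = (\<Prod>i=1..r. \<phi> i)"
    and "\<And>i. i \<in> {1..r} \<Longrightarrow> irreducible (\<phi> i)"
    and "inj_on \<phi> {1..r}"
    and "\<And>i. i \<in> {1..r} \<Longrightarrow> d i = degree (\<phi> i)"
    and "\<And>n. n \<ge> 1 \<Longrightarrow> a n = card {A :: 'a mat. A \<in> carrier_mat n n \<and> A ^\<^sub>m k = 1\<^sub>m n}"
  shows "1 + Abs_fps (\<lambda>n. if n \<ge> 1 then of_nat (a n) / GL_order n q else 0)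
       = (\<Prod>i=1..r. \<Sum>m. fps_const (1 / GL_order m (q ^ d i)) * fps_X ^ (m * d i))"
proof (rule fps_ext)
  fix n
  let ?\<Phi> = "\<phi> ` {1..r}"
  let ?c = "\<lambda>\<chi> m. 1 / GL_order m (q ^ degree \<chi>) :: rat"
  \<comment> \<open>The characteristic divides \<open>q\<close>, hence not \<open>k\<close>.\<close>
  have k: "of_nat k \<noteq> (0 :: 'a)"
  proof
    assume "of_nat k = (0 :: 'a)"
    then have "CHAR('a) dvd k" by (simp add: of_nat_eq_0_iff_char_dvd)
    moreover have "CHAR('a) dvd q" 
      using of_nat_card_eq_0[where 'a = 'a] assms(2) by (simp add: of_nat_eq_0_iff_char_dvd)
    ultimately have "CHAR('a) = 1" using assms(4) by (metis coprime_common_divisor_nat)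
    then show False using CHAR_not_1'[where 'a = 'a] by simp
  qed
  have pos: "degree \<chi> > 0" if "\<chi> \<in> ?\<Phi>" for \<chi>
    using that assms(6) by (auto intro!: irreducible_poly_degree_pos)
  have prod: "\<Prod>?\<Phi> = monom 1 k - 1"
    using assms(5,7) by (simp add: prod.reindex)
  have "(\<Prod>i=1..r. \<Sum>m. fps_const (1 / GL_order m (q ^ d i)) * fps_X ^ (m * d i)) =
      (\<Prod>i=1..r. Abs_fps (?c (\<phi> i)) oo fps_X ^ degree (\<phi> i))"
  proof (intro prod.cong refl)
    fix i assume i: "i \<in> {1..r}"
    then have "degree (\<phi> i) > 0" using pos by blast
    then show "(\<Sum>m. fps_const (1 / GL_order m (q ^ d i)) * fps_X ^ (m * d i)) =
        Abs_fps (?c (\<phi> i)) oo fps_X ^ degree (\<phi> i)"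
      unfolding assms(8)[OF i] by (intro sums_unique[symmetric] fps_sums_compose_power)
  qed
  also have "\<dots> = (\<Prod>\<chi>\<in>?\<Phi>. Abs_fps (?c \<chi>) oo fps_X ^ degree \<chi>)"
    using assms(7) by (simp add: prod.reindex)
  also have "\<dots> $ n = (\<Sum>M\<in>poly_types ?\<Phi> n. \<Prod>\<chi>\<in>?\<Phi>. ?c \<chi> (count M \<chi>))"
    using pos by (intro fps_nth_prod_compose_X_power) auto
  also have "\<dots> = of_nat (card (roots_of_one n k :: 'a mat set)) / GL_order n q"
    unfolding assms(2)[symmetric] using k assms(6) prod
    by (intro card_roots_of_one[symmetric]) auto
  also have "\<dots> = (1 + Abs_fps (\<lambda>n. if n \<ge> 1 then of_nat (a n) / GL_order n q else 0)) $ n"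
  proof (cases "n \<ge> 1")
    case True
    then show ?thesis using assms(9) by (simp add: roots_of_one_def)
  next
    case False
    then have "n = 0" by simp
    moreover have "roots_of_one 0 k = {1\<^sub>m 0 :: 'a mat}"
      by (auto simp: roots_of_one_def intro!: eq_matI)
    ultimately show ?thesis by (simp add: GL_order_def)
  qed
  finally show "(1 + Abs_fps (\<lambda>n. if n \<ge> 1 then of_nat (a n) / GL_order n q else 0)) $ n =
      (\<Prod>i=1..r. \<Sum>m. fps_const (1 / GL_order m (q ^ d i)) * fps_X ^ (m * d i)) $ n" ..
qed

end
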